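(* Let $n=3$, let $\varphi=(\varphi_1,\dots,\varphi_{\mathfrak{m}-n})\in C^\infty(B_r';\mathbb{R}^{\mathfrak{m}-n})$ and let $\mathbf{c}_{4,1}=(c_{1,4,1},\dots,c_{\mathfrak{m}-n,4,1})$ be the coefficient of $(y^n)^4\log y^n$ in the formal series solution (described in the context) of the minimal surface system with leading term $\varphi$. Then for $s=1,\dots,\mathfrak{m}-n$, $$c_{s,4,1}=-\frac18\sqrt{1+|D\varphi_s(y')|^2}\,\Bigl((\Delta_\Gamma H)^\perp-2|H|^2H+2Q(\operatorname{II})(H),\ \nu_s\Bigr),$$ where $H$ and $\operatorname{II}$ denote the mean curvature vector and the second fundamental form, at the point $(y',0,\varphi(y'))$, of the graph $\Gamma=\{(y',0,\varphi(y')):y'\in B_r'\}$, and $\nu_s$ is the unit normal vector $$\nu_s=\frac{(-D\varphi_s,\mathbf{e}_s)}{\sqrt{1+|D\varphi_s|^2}}.$$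
   Context: $n=3$ and $\mathfrak{m}>n$ an integer. $B_r'=\{y'=(y^1,\dots,y^{n-1}):|y'|<r\}$; $B_r^+=\{(y',y^n):|y'|<r,\ 0<y^n<r\}$. The minimal surface system for $\mathbf{u}=(u_1,\dots,u_{\mathfrak{m}-n})$ on $B_r^+$ is $$g^{ij}\frac{\partial^2u_s}{\partial y^i\partial y^j}-\frac{n}{y^n}\frac{\partial u_s}{\partial y^n}=0,\quad s=1,\dots,\mathfrak{m}-n,\qquad (g^{ij})=(g_{ij})^{-1},\quad g_{ij}=\delta_{ij}+\sum_{l=1}^{\mathfrak{m}-n}\partial_iu_l\,\partial_ju_l.$$ Formal series solution: given smooth $\varphi$ and an arbitrary smooth $\mathbf{c}_{n+1,0}$ on $B_r'$, the unique formal series $$\mathbf{u}=\varphi+\sum_{i=2}^n\mathbf{c}_i(y')(y^n)^i+\sum_{i=n+1}^\infty\sum_{j=0}^{\lfloor(i-1)/n\rfloor}\mathbf{c}_{i,j}(y')(y^n)^i(\log y^n)^j$$ with smooth coefficients that formally solves the system (coefficients being determined by matching terms $(y^n)^i(\log y^n)^j$). Points $(y',0,\varphi(y'))$ are written in the ordering $(y^1,\dots,y^{n-1},y^n,\text{remaining }\mathfrak{m}-n\text{ coordinates})$ of $\mathbb{R}^{\mathfrak{m}}$; $\Gamma$ is regarded as an $(n-1)$-dimensional submanifold of $\{y^n=0\}\cong\mathbb{R}^{\mathfrak{m}-1}$ with Euclidean metric. $\operatorname{II}$ is its normal-bundle-valued second fundamental form and $H=\frac{1}{n-1}\operatorname{tr}\operatorname{II}$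 its mean curvature vector. $\Delta_\Gamma H$ is the Laplace–Beltrami operator of $\Gamma$ applied componentwise to the $\mathbb{R}^{\mathfrak{m}-1}$-valued function $H$, and $(\cdot)^\perp$ is the orthogonal projection to the normal bundle $N\Gamma$. For a normal section $V$, $Q(\operatorname{II})(V)=\sum_{i,j}(V,\operatorname{II}_{ij})\operatorname{II}_{ij}$, with $\operatorname{II}_{ij}=\operatorname{II}(e_i,e_j)$ in an orthonormal tangent frame $\{e_i\}$. $(\cdot,\cdot)$ is the Euclidean inner product, and $\mathbf{e}_s$ is the $s$-th standard basis vector of $\mathbb{R}^{\mathfrak{m}-n}$. *)

theory Defs
  imports
    "HOL-Analysis.Analysis"
    "HOL-Computational_Algebra.Formal_Laurent_Series"
begin

text \<open>
  Here \<open>n = 3\<close>: the variable \<open>y' = (y\<^sup>1, y\<^sup>2)\<close> has type \<open>real^2\<close>, so that \<open>B_r'\<close> is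
  \<open>ball 0 r\<close>, and the codimension \<open>\<mm> - n \<ge> 1\<close> is the cardinality of the finite index type \<open>'k\<close>.
\<close>

section \<open>Smooth functions\<close>

text \<open>To be used with open \<open>S\<close> only.\<close>

fun C_k_on :: "nat \<Rightarrow> ('a::real_normed_vector \<Rightarrow> 'b::real_normed_vector) \<Rightarrow> 'a set \<Rightarrow> bool" where
  "C_k_on 0 f S \<longleftrightarrow> continuous_on S f"
| "C_k_on (Suc k) f S \<longleftrightarrow>
     (\<forall>x\<in>S. f differentiable (at x)) \<and> (\<forall>v. C_k_on k (\<lambda>x. frechet_derivative f (at x) v) S)"

definition smooth_on :: "'a set \<Rightarrow> ('a::real_normed_vector \<Rightarrow> 'b::real_normed_vector) \<Rightarrow> bool" where
  "smooth_on S f \<longleftrightarrow> (\<forall>k. C_k_on k f S)"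

definition pd :: "2 \<Rightarrow> (real^2 \<Rightarrow> 'b::real_normed_vector) \<Rightarrow> real^2 \<Rightarrow> 'b" where
  "pd k f y = frechet_derivative f (at y) (axis k 1)"

definition grad :: "(real^2 \<Rightarrow> real) \<Rightarrow> real^2 \<Rightarrow> real^2" where
  "grad f y = (\<chi> k. pd k f y)"

section \<open>Formal series in \<open>t = y\<^sup>n\<close> and \<open>log t\<close>\<close>

text \<open>
  A formal series \<open>\<Sum>\<^sub>i \<Sum>\<^sub>j a\<^sub>i\<^sub>j(y') t\<^sup>i (log t)\<^sup>j\<close> in which every power of \<open>t\<close> carries only finitely many
  powers of \<open>log t\<close> is a map from \<open>y'\<close> to the ring \<open>real poly fps\<close>: the power series variable
  is \<open>t\<close> and the polynomial variable is \<open>log t\<close>.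
\<close>

type_synonym log_series = "real^2 \<Rightarrow> real poly fps"

definition formal_pd :: "2 \<Rightarrow> log_series \<Rightarrow> log_series" where
  "formal_pd k F y =
     Abs_fps (\<lambda>i. Abs_poly (\<lambda>j. pd k (\<lambda>z. poly.coeff (fps_nth (F z) i) j) y))"

text \<open>
  Since \<open>\<partial>\<^sub>t (p(log t) t\<^sup>i) = (i p + p')(log t) t\<^sup>i\<^sup>-\<^sup>1\<close>, the following is the \<open>t\<close>-derivative
  of every series whose \<open>t\<^sup>0\<close>-coefficient is free of \<open>log t\<close>.  This is the case for the series of
  the ansatz below and for their first derivatives, so no \<open>t\<^sup>-\<^sup>1\<close>-term is lost.
\<close>

definition formal_dt :: "log_series \<Rightarrow> log_series" where
  "formal_dt F y =
     Abs_fps (\<lambda>i. of_nat (Suc i) * fps_nth (F y) (Suc i) + pderiv (fps_nth (F y) (Suc i)))"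

text \<open>The index \<open>3\<close> stands for \<open>y\<^sup>n = t\<close> (as an element of the type \<open>3\<close> it equals \<open>0\<close>).\<close>

definition formal_D :: "3 \<Rightarrow> log_series \<Rightarrow> log_series" where
  "formal_D i F = (if i = 1 then formal_pd 1 F else if i = 2 then formal_pd 2 F else formal_dt F)"

definition formal_metric :: "('k::finite \<Rightarrow> log_series) \<Rightarrow> real^2 \<Rightarrow> (real poly fps)^3^3" where
  "formal_metric u y =
     (\<chi> i j. (if i = j then 1 else 0) + (\<Sum>l\<in>UNIV. formal_D i (u l) y * formal_D j (u l) y))"

text \<open>
  The left-hand side of the \<open>s\<close>-th equation of the minimal surface system at \<open>y'\<close>,
  as a formal Laurent series in \<open>t\<close> because of the factor \<open>n / t\<close>.
\<close>

definition formal_mss :: "('k::finite \<Rightarrow> log_series) \<Rightarrow> 'k \<Rightarrow> real^2 \<Rightarrow> real poly fls" where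
  "formal_mss u s y =
     fps_to_fls (\<Sum>i\<in>UNIV. \<Sum>j\<in>UNIV.
       matrix_inv (formal_metric u y) $ i $ j * formal_D i (formal_D j (u s)) y)
     - 3 * fls_X_inv * fps_to_fls (formal_D 3 (u s) y)"

definition formally_solves_on :: "(real^2) set \<Rightarrow> ('k::finite \<Rightarrow> log_series) \<Rightarrow> bool" where
  "formally_solves_on S u \<longleftrightarrow> (\<forall>y\<in>S. \<forall>s. formal_mss u s y = 0)"

text \<open>
  \<open>\<phi> + c\<^sub>2 t\<^sup>2 + c\<^sub>3 t\<^sup>3 + \<Sum>\<^sub>i\<^sub>\<ge>\<^sub>4 \<Sum>\<^sub>j\<^sub>\<le>\<^sub>\<lfloor>\<^sub>(\<^sub>i\<^sub>-\<^sub>1\<^sub>)\<^sub>/\<^sub>3\<^sub>\<rfloor> d\<^sub>i\<^sub>j t\<^sup>i (log t)\<^sup>j\<close>; the values \<open>c i\<close> for \<open>i \<notin> {2, 3}\<close> and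
  \<open>d i j\<close> for \<open>i < 4\<close> or \<open>j > (i - 1) div 3\<close> are irrelevant.
\<close>

definition log_ansatz ::
  "(real^2 \<Rightarrow> real^'k) \<Rightarrow> (nat \<Rightarrow> real^2 \<Rightarrow> real^'k) \<Rightarrow> (nat \<Rightarrow> nat \<Rightarrow> real^2 \<Rightarrow> real^'k)
     \<Rightarrow> 'k::finite \<Rightarrow> log_series" where
  "log_ansatz \<phi> c d s y = Abs_fps (\<lambda>i.
     if i = 0 then [:\<phi> y $ s:]
     else if i = 1 then 0
     else if i \<le> 3 then [:c i y $ s:]
     else (\<Sum>j\<le>(i - 1) div 3. monom (d i j y $ s) j))"

section \<open>Geometry of the graph\<close>

text \<open>
  \<open>{y\<^sup>n = 0} \<cong> \<real>\<^bsup>\<mm>-1\<^esup>\<close> is rendered as \<open>real^2 \<times> real^'k\<close> with the (Euclidean) product inner product,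
  and \<open>\<Gamma>\<close> is the image of \<open>graph_map \<phi>\<close>.  Tensors and functions on \<open>\<Gamma>\<close> are written as
  functions of the base point \<open>y'\<close>, standing for the point \<open>(y', \<phi>(y'))\<close> of \<open>\<Gamma>\<close>.
\<close>

definition graph_map :: "(real^2 \<Rightarrow> real^'k::finite) \<Rightarrow> real^2 \<Rightarrow> (real^2) \<times> (real^'k)" where
  "graph_map \<phi> y = (y, \<phi> y)"

definition tangent_space ::
  "(real^2 \<Rightarrow> real^'k::finite) \<Rightarrow> real^2 \<Rightarrow> ((real^2) \<times> (real^'k)) set" where
  "tangent_space \<phi> y = range (frechet_derivative (graph_map \<phi>) (at y))"

definition normal_proj ::
  "(real^2 \<Rightarrow> real^'k::finite) \<Rightarrow> real^2 \<Rightarrow> (real^2) \<times> (real^'k) \<Rightarrow> (real^2) \<times> (real^'k)" where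
  "normal_proj \<phi> y v =
     (THE w. w \<in> orthogonal_comp (tangent_space \<phi> y) \<and> v - w \<in> tangent_space \<phi> y)"

text \<open>
  \<open>II(v, w) = (D\<^sub>v W)\<^sup>\<bottom>\<close> for a tangent field \<open>W\<close> along \<open>\<Gamma>\<close> with \<open>W = w\<close> at the point. As a tangent vector
  at \<open>y\<close> is \<open>w = dX\<^sub>y (fst w)\<close> with \<open>X = graph_map \<phi>\<close>, the field \<open>W(z) = dX\<^sub>z (fst w)\<close> is such an
  extension, and differentiation along \<open>v\<close> is differentiation in the parameter along \<open>fst v\<close>.
  Meaningful for \<open>v, w \<in> tangent_space \<phi> y\<close>.
\<close>

definition second_ff ::
  "(real^2 \<Rightarrow> real^'k::finite) \<Rightarrow> real^2 \<Rightarrow> (real^2) \<times> (real^'k) \<Rightarrow> (real^2) \<times> (real^'k)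
     \<Rightarrow> (real^2) \<times> (real^'k)" where
  "second_ff \<phi> y v w = normal_proj \<phi> y
     (frechet_derivative (\<lambda>z. frechet_derivative (graph_map \<phi>) (at z) (fst w)) (at y) (fst v))"

text \<open>
  Some orthonormal frame of the tangent space; the trace and \<open>Q\<close> below do not depend on its choice.
\<close>

definition tangent_frame ::
  "(real^2 \<Rightarrow> real^'k::finite) \<Rightarrow> real^2 \<Rightarrow> ((real^2) \<times> (real^'k)) set" where
  "tangent_frame \<phi> y =
     (SOME B. pairwise orthogonal B \<and> (\<forall>e\<in>B. norm e = 1) \<and> span B = tangent_space \<phi> y)"

definition mean_curvature ::
  "(real^2 \<Rightarrow> real^'k::finite) \<Rightarrow> real^2 \<Rightarrow> (real^2) \<times> (real^'k)" where
  "mean_curvature \<phi> y = (1 / 2) *\<^sub>R (\<Sum>e\<in>tangent_frame \<phi> y. second_ff \<phi> y e e)"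

definition Q_II ::
  "(real^2 \<Rightarrow> real^'k::finite) \<Rightarrow> real^2 \<Rightarrow> (real^2) \<times> (real^'k) \<Rightarrow> (real^2) \<times> (real^'k)" where
  "Q_II \<phi> y V = (\<Sum>e\<in>tangent_frame \<phi> y. \<Sum>e'\<in>tangent_frame \<phi> y.
     (V \<bullet> second_ff \<phi> y e e') *\<^sub>R second_ff \<phi> y e e')"

definition graph_metric :: "(real^2 \<Rightarrow> real^'k::finite) \<Rightarrow> real^2 \<Rightarrow> real^2^2" where
  "graph_metric \<phi> y = (\<chi> a b. pd a (graph_map \<phi>) y \<bullet> pd b (graph_map \<phi>) y)"

text \<open>\<open>\<Delta>\<^sub>\<Gamma> f = (det g)\<^sup>-\<^sup>1\<^sup>/\<^sup>2 \<partial>\<^sub>a ((det g)\<^sup>1\<^sup>/\<^sup>2 g\<^sup>a\<^sup>b \<partial>\<^sub>b f)\<close> in the graph coordinates \<open>y'\<close>.\<close>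

definition laplace_beltrami ::
  "(real^2 \<Rightarrow> real^'k::finite) \<Rightarrow> (real^2 \<Rightarrow> real) \<Rightarrow> real^2 \<Rightarrow> real" where
  "laplace_beltrami \<phi> f y =
     (\<Sum>a\<in>UNIV. pd a (\<lambda>z. sqrt (det (graph_metric \<phi> z)) *
         (\<Sum>b\<in>UNIV. matrix_inv (graph_metric \<phi> z) $ a $ b * pd b f z)) y)
     / sqrt (det (graph_metric \<phi> y))"

definition laplace_beltrami_vec ::
  "(real^2 \<Rightarrow> real^'k::finite) \<Rightarrow> (real^2 \<Rightarrow> (real^2) \<times> (real^'k)) \<Rightarrow> real^2
     \<Rightarrow> (real^2) \<times> (real^'k)" where
  "laplace_beltrami_vec \<phi> F y = (\<Sum>b\<in>Basis. laplace_beltrami \<phi> (\<lambda>z. F z \<bullet> b) y *\<^sub>R b)"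

definition unit_normal ::
  "(real^2 \<Rightarrow> real^'k::finite) \<Rightarrow> 'k \<Rightarrow> real^2 \<Rightarrow> (real^2) \<times> (real^'k)" where
  "unit_normal \<phi> s y =
     (1 / sqrt (1 + (norm (grad (\<lambda>z. \<phi> z $ s) y))\<^sup>2)) *\<^sub>R (- grad (\<lambda>z. \<phi> z $ s) y, axis s 1)"

end

theory Submission
  imports Defs
begin

text \<open>
  With \<open>c = c\<^sub>2\<close>, the \<open>t\<^sup>0\<close>-coefficient of the system says \<open>4 c = g\<^sup>a\<^sup>b \<partial>\<^sub>a\<^sub>b \<phi>\<close>, that is, \<open>H\<close> is twice the normal part of
  \<open>(0, c)\<close>.  In the \<open>t\<^sup>2\<close>-coefficient at \<open>log t = 0\<close> the free coefficient \<open>c\<^sub>4\<^sub>,\<^sub>0\<close> cancels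
  (4 is the resonant exponent) and \<open>c\<^sub>3\<close> is never paired with a nonzero term, which leaves \<open>4 c\<^sub>4\<^sub>,\<^sub>1\<close> as an expression
  in \<open>\<phi>\<close> and \<open>c\<close>.  On the other side, with \<open>p\<^sub>a = 2 \<partial>\<^sub>a\<phi> \<bullet> c\<close> and \<open>X\<close> the graph map,
  \<open>H = 2 (0, c) - p\<^sup>a \<partial>\<^sub>aX\<close> and \<open>\<Delta>\<^sub>\<Gamma> f = g\<^sup>a\<^sup>b \<partial>\<^sub>a\<^sub>b f - 2 p\<^sup>b \<partial>\<^sub>b f\<close>; pairing with the fixed normal
  vector \<open>(- D\<phi>\<^sub>s, e\<^sub>s)\<close> and using the derivative of \<open>4 c = g\<^sup>a\<^sup>b \<partial>\<^sub>a\<^sub>b \<phi>\<close> to remove third derivatives of \<open>\<phi>\<close> gives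
  the same expression.
\<close>

text \<open>Otherwise every \<open>$\<close> is ambiguous between \<^const>\<open>fps_nth\<close> and \<^const>\<open>vec_nth\<close>.\<close>

no_notation fps_nth (infixl \<open>$\<close> 75)

section \<open>Smooth functions and partial derivatives\<close>

text \<open>The resonance: on \<open>t^i\<close> the operator \<open>u_tt - 3 u_t / t\<close> has
  the factor \<open>i (i - 4)\<close>, which vanishes at 4. Its derivative in \<open>i\<close>,
  namely \<open>2 i - 4\<close>, is the factor 4 that \<open>t^4 log t\<close> leaves at
  \<open>log t = 0\<close>. The constant 1/8 combines this 4 with the 2 in front of the normal part
  of \<open>(0, c)\<close>: the curvature expression paired with the normal vector is twice the rest
  of the order-2 coefficient.

  Two obstacles shape the proof. The inverse of the formal metric is a choice over a ring that is
  not a field, so its entries are accessible only once the determinant is known to be a unit, and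
  then only through the product with the metric, compared order by order. Moreover, applying the
  Laplacian to the tangential part of \<open>H\<close> produces second derivatives of its
  coefficients, which hide third derivatives of \<open>\<phi>\<close>. With the normal frozen at
  \<open>y\<close>, the pairing of the moving tangent vectors with it vanishes at \<open>y\<close>,
  so these second derivatives drop out. The third derivatives that remain are contracted with the
  inverse metric, which is the shape controlled by the differentiated trace equation.\<close>

lemma C_k_on_cong_open:
  assumes "open S" "\<And>x. x \<in> S \<Longrightarrow> f x = g x" "C_k_on k f S"
  shows "C_k_on k g S"
  using assms(2,3)
proof (induction k arbitrary: f g)
  case 0
  then have "continuous_on S f" by simp
  then have "continuous_on S g"
    by (rule continuous_on_eq) (rule 0)
  then show ?case by simp
next
  case (Suc k)
  have df: "\<forall>x\<in>S. f differentiable (at x)" and ck: "\<And>v. C_k_on k (\<lambda>x. frechet_derivative f (at x) v) S"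
    using Suc.prems(2) by simp_all
  have D: "(g has_derivative frechet_derivative f (at x)) (at x)" if "x \<in> S" for x
    by (rule has_derivative_transform_within_open[OF _ assms(1) that])
     (use df that frechet_derivative_works Suc.prems(1) in blast)+
  then have e: "frechet_derivative f (at x) = frechet_derivative g (at x)" if "x \<in> S" for x
    using frechet_derivative_at that by blast
  have "C_k_on k (\<lambda>x. frechet_derivative g (at x) v) S" for v
    by (rule Suc.IH[OF _ ck[of v]]) (simp only: e)
  moreover have "\<forall>x\<in>S. g differentiable (at x)"
    using D differentiableI by blast
  ultimately show ?case by simp
qed

lemma C_k_on_SucD: "C_k_on (Suc k) f S \<Longrightarrow> C_k_on k f S"
proof (induction k arbitrary: f)
  case 0
  then have "f differentiable (at x)" if "x \<in> S" for x
    using that by simp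
  then show ?case
    by (auto intro!: continuous_at_imp_continuous_on differentiable_imp_continuous_within)
next
  case (Suc k)
  then have "\<forall>x\<in>S. f differentiable (at x)"
    and "C_k_on (Suc k) (\<lambda>x. frechet_derivative f (at x) v) S" for v
    by (metis C_k_on.simps(2))+
  with Suc.IH show ?case by simp
qed

text \<open>Accepts the derivative in the form given by any \<open>has_derivative\<close> rule; each
  closure property below is such a rule combined with the induction hypothesis.\<close>

lemma C_k_on_SucI:
  assumes "open S" "\<And>x. x \<in> S \<Longrightarrow> (f has_derivative f' x) (at x)"
    "\<And>v. C_k_on k (\<lambda>x. f' x v) S"
  shows "C_k_on (Suc k) f S"
proof -
  have "f' x = frechet_derivative f (at x)" if "x \<in> S" for x
    using assms(2)[OF that] by (rule frechet_derivative_at)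
  then have "C_k_on k (\<lambda>x. frechet_derivative f (at x) v) S" for v
    by (intro C_k_on_cong_open[OF assms(1) _ assms(3)[of v]]) simp
  moreover have "\<forall>x\<in>S. f differentiable (at x)"
    using assms(2) differentiableI by blast
  ultimately show ?thesis by simp
qed

lemma has_derivative_frechet: "f differentiable (at y) \<Longrightarrow> (f has_derivative frechet_derivative f (at y)) (at y)"
  by (rule frechet_derivative_works[THEN iffD1])

lemma C_k_on_SucE:
  assumes "C_k_on (Suc k) f S"
  shows "\<And>x. x \<in> S \<Longrightarrow> (f has_derivative frechet_derivative f (at x)) (at x)"
    "\<And>v. C_k_on k (\<lambda>x. frechet_derivative f (at x) v) S"
  using assms by (simp_all only: C_k_on.simps has_derivative_frechet)

lemma C_k_on_const: "C_k_on k (\<lambda>x. c) S"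
  by (induction k arbitrary: c) auto

lemma C_k_on_add:
  assumes "open S" "C_k_on k f S" "C_k_on k g S"
  shows "C_k_on k (\<lambda>x. f x + g x) S"
  using assms(2,3)
proof (induction k arbitrary: f g)
  case 0 then show ?case by (auto intro: continuous_on_add)
next
  case (Suc k)
  note fg = C_k_on_SucE[OF Suc.prems(1)] C_k_on_SucE[OF Suc.prems(2)]
  show ?case
    by (rule C_k_on_SucI[OF assms(1) has_derivative_add[OF fg(1) fg(3)] Suc.IH[OF fg(2) fg(4)]])
qed

lemma C_k_on_bounded_linear:
  assumes "bounded_linear h" "open S" "C_k_on k f S"
  shows "C_k_on k (\<lambda>x. h (f x)) S"
  using assms(3)
proof (induction k arbitrary: f)
  case 0 then show ?case using assms(1) by (auto intro: bounded_linear.continuous_on)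
next
  case (Suc k)
  note f = C_k_on_SucE[OF Suc.prems]
  show ?case
    by (rule C_k_on_SucI[OF assms(2) bounded_linear.has_derivative[OF assms(1) f(1)] Suc.IH[OF f(2)]])
qed

text \<open>Each summand of the Leibniz rule keeps one factor undifferentiated, and
  \<open>C_k_on_SucD\<close> lowers that factor to the order of the induction hypothesis.\<close>

lemma C_k_on_bounded_bilinear:
  assumes "bounded_bilinear h" "open S" "C_k_on k f S" "C_k_on k g S"
  shows "C_k_on k (\<lambda>x. h (f x) (g x)) S"
  using assms(3,4)
proof (induction k arbitrary: f g)
  case 0 then show ?case using assms(1) by (auto intro: bounded_bilinear.continuous_on)
next
  case (Suc k)
  note fg = C_k_on_SucE[OF Suc.prems(1)] C_k_on_SucE[OF Suc.prems(2)]
  show ?case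
    by (rule C_k_on_SucI[OF assms(2) bounded_bilinear.FDERIV[OF assms(1) fg(1) fg(3)]
          C_k_on_add[OF assms(2) Suc.IH[OF C_k_on_SucD[OF Suc.prems(1)] fg(4)]
            Suc.IH[OF fg(2) C_k_on_SucD[OF Suc.prems(2)]]]])
qed

text \<open>The derivative of \<open>1 / f\<close> is \<open>- (1 / f) f' (1 / f)\<close>, where
  \<open>1 / f\<close> reappears at one order less; the induction supplies exactly this.\<close>

lemma C_k_on_inverse:
  fixes f :: "'a::real_normed_vector \<Rightarrow> real"
  assumes "open S" "\<And>x. x \<in> S \<Longrightarrow> f x \<noteq> 0" "C_k_on k f S"
  shows "C_k_on k (\<lambda>x. inverse (f x)) S"
  using assms(3)
proof (induction k)
  case 0 then show ?case using assms(2) by (auto intro: continuous_on_inverse)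
next
  case (Suc k)
  note f = C_k_on_SucE[OF Suc.prems]
  have "C_k_on k (\<lambda>x. inverse (f x)) S"
    using Suc.IH[OF C_k_on_SucD[OF Suc.prems]] .
  then have "C_k_on k (\<lambda>x. - (inverse (f x) * frechet_derivative f (at x) v * inverse (f x))) S" for v
    using f(2)[of v]
    by (intro C_k_on_bounded_bilinear[OF bounded_bilinear_mult assms(1)]
        C_k_on_bounded_linear[OF bounded_linear_minus[OF bounded_linear_ident] assms(1)])
  note d = this
  show ?case
    by (rule C_k_on_SucI[OF assms(1) Deriv.has_derivative_inverse[OF assms(2) f(1)] d])
qed

lemma smooth_on_cong_open:
  "open S \<Longrightarrow> (\<And>x. x \<in> S \<Longrightarrow> f x = g x) \<Longrightarrow> smooth_on S f \<Longrightarrow> smooth_on S g"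
  unfolding smooth_on_def using C_k_on_cong_open by metis

lemma smooth_on_const [simp]: "smooth_on S (\<lambda>x. c)"
  by (simp add: smooth_on_def C_k_on_const)

lemma smooth_on_add:
  "open S \<Longrightarrow> smooth_on S f \<Longrightarrow> smooth_on S g \<Longrightarrow> smooth_on S (\<lambda>x. f x + g x)"
  by (simp add: smooth_on_def C_k_on_add)

lemma smooth_on_bounded_linear:
  "bounded_linear h \<Longrightarrow> open S \<Longrightarrow> smooth_on S f \<Longrightarrow> smooth_on S (\<lambda>x. h (f x))"
  by (simp add: smooth_on_def C_k_on_bounded_linear)

lemma smooth_on_bounded_bilinear:
  "bounded_bilinear h \<Longrightarrow> open S \<Longrightarrow> smooth_on S f \<Longrightarrow> smooth_on S g \<Longrightarrow> smooth_on S (\<lambda>x. h (f x) (g x))"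
  by (simp add: smooth_on_def C_k_on_bounded_bilinear)

lemma smooth_on_mult:
  fixes f g :: "'a::real_normed_vector \<Rightarrow> real"
  shows "open S \<Longrightarrow> smooth_on S f \<Longrightarrow> smooth_on S g \<Longrightarrow> smooth_on S (\<lambda>x. f x * g x)"
  by (rule smooth_on_bounded_bilinear[OF bounded_bilinear_mult])

lemma smooth_on_minus:
  "open S \<Longrightarrow> smooth_on S f \<Longrightarrow> smooth_on S (\<lambda>x. - f x)"
  by (rule smooth_on_bounded_linear[OF bounded_linear_minus[OF bounded_linear_ident]])

lemma smooth_on_diff:
  "open S \<Longrightarrow> smooth_on S f \<Longrightarrow> smooth_on S g \<Longrightarrow> smooth_on S (\<lambda>x. f x - g x)"
  using smooth_on_add[of S f "\<lambda>x. - g x"] smooth_on_minus by auto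

lemma smooth_on_inner:
  fixes f g :: "'a::real_normed_vector \<Rightarrow> 'b::real_inner"
  shows "open S \<Longrightarrow> smooth_on S f \<Longrightarrow> smooth_on S g \<Longrightarrow> smooth_on S (\<lambda>x. f x \<bullet> g x)"
  by (rule smooth_on_bounded_bilinear[OF bounded_bilinear_inner])

lemma smooth_on_vec_nth:
  "open S \<Longrightarrow> smooth_on S f \<Longrightarrow> smooth_on S (\<lambda>x. f x $ i)"
  by (rule smooth_on_bounded_linear[OF bounded_linear_vec_nth])

lemma smooth_on_sum:
  "open S \<Longrightarrow> (\<And>i. i \<in> I \<Longrightarrow> smooth_on S (f i)) \<Longrightarrow> smooth_on S (\<lambda>x. \<Sum>i\<in>I. f i x)"
  by (induction I rule: infinite_finite_induct) (auto intro: smooth_on_add)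

lemma smooth_on_divide:
  fixes f g :: "'a::real_normed_vector \<Rightarrow> real"
  assumes "open S" "smooth_on S f" "smooth_on S g" "\<And>x. x \<in> S \<Longrightarrow> g x \<noteq> 0"
  shows "smooth_on S (\<lambda>x. f x / g x)"
  unfolding divide_inverse
  by (intro smooth_on_mult assms) (use assms in \<open>auto simp: smooth_on_def intro: C_k_on_inverse\<close>)

lemma smooth_on_imp_differentiable: "smooth_on S f \<Longrightarrow> x \<in> S \<Longrightarrow> f differentiable (at x)"
  unfolding smooth_on_def by (metis C_k_on.simps(2))

lemma smooth_on_frechet_derivative:
  "smooth_on S f \<Longrightarrow> smooth_on S (\<lambda>x. frechet_derivative f (at x) v)"
  unfolding smooth_on_def by (metis C_k_on.simps(2))

lemma smooth_on_pd: "smooth_on S f \<Longrightarrow> smooth_on S (pd k f)"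
  unfolding pd_def[abs_def] by (rule smooth_on_frechet_derivative)

section \<open>Symmetry of second derivatives\<close>

lemma has_real_derivative_along_line:
  fixes f :: "'a::real_normed_vector \<Rightarrow> real"
  assumes "f differentiable (at (x + t *\<^sub>R v))"
  shows "((\<lambda>t. f (x + t *\<^sub>R v)) has_real_derivative frechet_derivative f (at (x + t *\<^sub>R v)) v) (at t)"
proof -
  have "((\<lambda>t. x + t *\<^sub>R v) has_derivative (\<lambda>t. t *\<^sub>R v)) (at t)"
    by (auto intro!: derivative_eq_intros)
  then have "(f \<circ> (\<lambda>t. x + t *\<^sub>R v) has_derivative
      frechet_derivative f (at (x + t *\<^sub>R v)) \<circ> (\<lambda>t. t *\<^sub>R v)) (at t)"
    by (rule diff_chain_at) (rule has_derivative_frechet[OF assms])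
  moreover have "frechet_derivative f (at (x + t *\<^sub>R v)) \<circ> (\<lambda>t. t *\<^sub>R v)
      = (*) (frechet_derivative f (at (x + t *\<^sub>R v)) v)"
    using linear_scale[OF linear_frechet_derivative[OF assms]] by (auto simp: fun_eq_iff)
  ultimately show ?thesis
    by (simp add: has_field_derivative_def o_def)
qed

text \<open>The mean value theorem twice: in direction \<open>u\<close> for the increment of
  \<open>f\<close> along \<open>h v\<close>, then in direction \<open>v\<close> for the derivative
  so obtained. The second difference is symmetric in \<open>u\<close> and \<open>v\<close>, while
  the mixed derivative is not visibly so.\<close>

lemma second_difference_mvt:
  fixes f :: "'a::real_normed_vector \<Rightarrow> real"
  assumes S: "smooth_on S f" and sub: "ball x e \<subseteq> S" and h: "0 < h" "h * (norm u + norm v) < e"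
  shows "\<exists>p. dist x p < e \<and> dist x p \<le> h * (norm u + norm v) \<and>
     f (x + h *\<^sub>R u + h *\<^sub>R v) - f (x + h *\<^sub>R u) - f (x + h *\<^sub>R v) + f x
       = h\<^sup>2 * frechet_derivative (\<lambda>z. frechet_derivative f (at z) u) (at p) v"
proof -
  have inb: "norm (a *\<^sub>R u + b *\<^sub>R v) \<le> h * (norm u + norm v)" if "0 \<le> a" "a \<le> h" "0 \<le> b" "b \<le> h" for a b
  proof -
    have "norm (a *\<^sub>R u + b *\<^sub>R v) \<le> a * norm u + b * norm v"
      using that norm_triangle_ineq[of "a *\<^sub>R u" "b *\<^sub>R v"] by simp
    also have "\<dots> \<le> h * norm u + h * norm v"
      using that by (intro add_mono mult_right_mono) auto
    finally show ?thesis by (simp add: algebra_simps)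
  qed
  have inS: "x + a *\<^sub>R u + b *\<^sub>R v \<in> S" if "0 \<le> a" "a \<le> h" "0 \<le> b" "b \<le> h" for a b
  proof -
    have "dist x (x + a *\<^sub>R u + b *\<^sub>R v) = norm (a *\<^sub>R u + b *\<^sub>R v)"
      by (metis add.assoc add_diff_cancel_left' dist_commute dist_norm)
    then show ?thesis
      using le_less_trans[OF inb[OF that] h(2)] sub by (auto simp: subset_iff)
  qed
  let ?fu = "\<lambda>z. frechet_derivative f (at z) u"
  let ?g = "\<lambda>t. f ((x + h *\<^sub>R v) + t *\<^sub>R u) - f (x + t *\<^sub>R u)"
  have "\<exists>z>0. z < h \<and> ?g h - ?g 0 = (h - 0) * (?fu ((x + h *\<^sub>R v) + z *\<^sub>R u) - ?fu (x + z *\<^sub>R u))"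
  proof (rule MVT2[OF h(1)])
    fix t assume t: "0 \<le> t" "t \<le> h"
    show "(?g has_real_derivative (?fu ((x + h *\<^sub>R v) + t *\<^sub>R u) - ?fu (x + t *\<^sub>R u))) (at t)"
      using inS[of t h] inS[of t 0] t h(1)
      by (intro DERIV_diff has_real_derivative_along_line smooth_on_imp_differentiable[OF S])
        (auto simp: algebra_simps)
  qed
  then obtain a where a: "0 < a" "a < h"
    and ea: "?g h - ?g 0 = h * (?fu ((x + h *\<^sub>R v) + a *\<^sub>R u) - ?fu (x + a *\<^sub>R u))" by auto
  let ?k = "\<lambda>t. ?fu ((x + a *\<^sub>R u) + t *\<^sub>R v)"
  have "\<exists>z>0. z < h \<and> ?k h - ?k 0 = (h - 0) * frechet_derivative ?fu (at ((x + a *\<^sub>R u) + z *\<^sub>R v)) v"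
  proof (rule MVT2[OF h(1)])
    fix t assume t: "0 \<le> t" "t \<le> h"
    show "(?k has_real_derivative frechet_derivative ?fu (at ((x + a *\<^sub>R u) + t *\<^sub>R v)) v) (at t)"
      using inS[of a t] t a
      by (intro has_real_derivative_along_line
          smooth_on_imp_differentiable[OF smooth_on_frechet_derivative[OF S]]) auto
  qed
  then obtain b where b: "0 < b" "b < h"
    and eb: "?k h - ?k 0 = h * frechet_derivative ?fu (at ((x + a *\<^sub>R u) + b *\<^sub>R v)) v" by auto
  let ?p = "x + a *\<^sub>R u + b *\<^sub>R v"
  have "dist x ?p \<le> h * (norm u + norm v)"
    using inb[of a b] a b by (simp add: dist_norm norm_minus_commute add.assoc diff_diff_eq2 flip: norm_minus_cancel[of "a *\<^sub>R u + b *\<^sub>R v"])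
  moreover have "f (x + h *\<^sub>R u + h *\<^sub>R v) - f (x + h *\<^sub>R u) - f (x + h *\<^sub>R v) + f x
     = h * (?fu ((x + h *\<^sub>R v) + a *\<^sub>R u) - ?fu (x + a *\<^sub>R u))"
    using ea by (simp add: add_ac)
  moreover have "?fu ((x + h *\<^sub>R v) + a *\<^sub>R u) - ?fu (x + a *\<^sub>R u) = h * frechet_derivative ?fu (at ?p) v"
    using eb by (simp add: add_ac)
  ultimately show ?thesis
    using h(2) by (intro exI[of _ ?p]) (auto simp: power2_eq_square)
qed

text \<open>Exchanging \<open>u\<close> and \<open>v\<close> leaves the second difference unchanged,
  so \<open>F u v p = F v u q\<close> for points \<open>p\<close>, \<open>q\<close> arbitrarily
  close to \<open>x\<close>; continuity of both sides carries this to \<open>x\<close>.\<close>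

lemma frechet_derivative_commute:
  fixes f :: "'a::real_normed_vector \<Rightarrow> real"
  assumes S: "smooth_on S f" "open S" "x \<in> S"
  shows "frechet_derivative (\<lambda>z. frechet_derivative f (at z) u) (at x) v
       = frechet_derivative (\<lambda>z. frechet_derivative f (at z) v) (at x) u"
proof -
  define F where "F = (\<lambda>u v z. frechet_derivative (\<lambda>z. frechet_derivative f (at z) u) (at z) v)"
  obtain e where e: "e > 0" "ball x e \<subseteq> S"
    using S open_contains_ball by blast
  have cont: "isCont (F a b) x" for a b
  proof -
    have "smooth_on S (F a b)"
      unfolding F_def by (intro smooth_on_frechet_derivative S)
    then show ?thesis
      using S smooth_on_imp_differentiable differentiable_imp_continuous_within by blast
  qed
  have "\<bar>F u v x - F v u x\<bar> \<le> \<delta>" if "\<delta> > 0" for \<delta>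
  proof -
    have "\<exists>d>0. \<forall>p. dist x p < d \<longrightarrow> dist (F a b p) (F a b x) < \<delta>/2" for a b
    proof -
      have "\<delta>/2 > 0" using that by simp
      then show ?thesis
        using cont[of a b] unfolding continuous_at_eps_delta dist_commute[of x] by blast
    qed
    then obtain d1 d2 where d1: "d1 > 0" "\<And>p. dist x p < d1 \<Longrightarrow> dist (F u v p) (F u v x) < \<delta>/2"
      and d2: "d2 > 0" "\<And>p. dist x p < d2 \<Longrightarrow> dist (F v u p) (F v u x) < \<delta>/2"
      by metis
    define m where "m = min e (min d1 d2)"
    \<comment> \<open>The summand 1 keeps the denominator positive when \<open>u\<close> and
      \<open>v\<close> are 0; the factor 2 makes the bound by \<open>m\<close> strict.\<close>
    define h where "h = m / (2 * (norm u + norm v + 1))"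
    have m: "m > 0" using e d1 d2 by (simp add: m_def)
    have pos: "norm u + norm v + 1 > 0" by (smt (verit) norm_ge_zero)
    then have h: "h > 0" using m by (simp add: h_def)
    have "h * (norm u + norm v) \<le> h * (norm u + norm v + 1)"
      using h by simp
    also have "\<dots> = m / 2" using pos by (simp add: h_def field_simps)
    finally have hm: "h * (norm u + norm v) < m" using m by simp
    have he: "h * (norm u + norm v) < e" "h * (norm v + norm u) < e"
      using hm by (simp_all add: m_def add.commute)
    obtain p where p: "dist x p \<le> h * (norm u + norm v)"
      "f (x + h *\<^sub>R u + h *\<^sub>R v) - f (x + h *\<^sub>R u) - f (x + h *\<^sub>R v) + f x = h\<^sup>2 * F u v p"
      using second_difference_mvt[OF S(1) e(2) h he(1)] unfolding F_def by blast
    obtain q where q: "dist x q \<le> h * (norm v + norm u)"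
      "f (x + h *\<^sub>R v + h *\<^sub>R u) - f (x + h *\<^sub>R v) - f (x + h *\<^sub>R u) + f x = h\<^sup>2 * F v u q"
      using second_difference_mvt[OF S(1) e(2) h he(2)] unfolding F_def by blast
    have "h\<^sup>2 * F u v p = h\<^sup>2 * F v u q"
      using p(2) q(2) by (simp add: algebra_simps)
    then have "F u v p = F v u q" using h by simp
    moreover have "dist x p < d1" "dist x q < d2"
      using p(1) q(1) hm by (simp_all add: m_def add.commute)
    ultimately show ?thesis
      using d1(2)[of p] d2(2)[of q] unfolding dist_real_def by linarith
  qed
  then have "\<bar>F u v x - F v u x\<bar> \<le> 0"
    using field_le_epsilon[of "\<bar>F u v x - F v u x\<bar>" 0] by simp
  then show ?thesis by (simp add: F_def)
qed

section \<open>Calculus rules for \<open>pd\<close>\<close>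

lemma pd_eqI: "(f has_derivative f') (at y) \<Longrightarrow> pd k f y = f' (axis k 1)"
  unfolding pd_def by (metis frechet_derivative_at)

lemma pd_const [simp]: "pd k (\<lambda>z. c) y = 0"
  by (simp add: pd_def)

lemma pd_bounded_linear:
  assumes "bounded_linear h" "f differentiable (at y)"
  shows "pd k (\<lambda>z. h (f z)) y = h (pd k f y)"
  using pd_eqI[OF bounded_linear.has_derivative[OF assms(1) has_derivative_frechet[OF assms(2)]]]
  by (simp only: pd_def)

lemma pd_bounded_bilinear:
  assumes "bounded_bilinear h" "f differentiable (at y)" "g differentiable (at y)"
  shows "pd k (\<lambda>z. h (f z) (g z)) y = h (pd k f y) (g y) + h (f y) (pd k g y)"
  using pd_eqI[OF bounded_bilinear.FDERIV[OF assms(1) assms(2,3)[THEN has_derivative_frechet]]]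
  by (simp only: pd_def add.commute)

lemma pd_add:
  assumes "f differentiable (at y)" "g differentiable (at y)"
  shows "pd k (\<lambda>z. f z + g z) y = pd k f y + pd k g y"
  using pd_eqI[OF has_derivative_add[OF assms[THEN has_derivative_frechet]]]
  by (simp only: pd_def)

lemma pd_diff:
  assumes "f differentiable (at y)" "g differentiable (at y)"
  shows "pd k (\<lambda>z. f z - g z) y = pd k f y - pd k g y"
  using pd_eqI[OF has_derivative_diff[OF assms[THEN has_derivative_frechet]]]
  by (simp only: pd_def)

lemma pd_sum:
  assumes "\<And>i. i \<in> I \<Longrightarrow> f i differentiable (at y)"
  shows "pd k (\<lambda>z. \<Sum>i\<in>I. f i z) y = (\<Sum>i\<in>I. pd k (f i) y)"
  using pd_eqI[OF has_derivative_sum[OF has_derivative_frechet[OF assms]]]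
  by (simp only: pd_def)

lemma pd_mult:
  fixes f g :: "real^2 \<Rightarrow> real"
  assumes "f differentiable (at y)" "g differentiable (at y)"
  shows "pd k (\<lambda>z. f z * g z) y = pd k f y * g y + f y * pd k g y"
  by (rule pd_bounded_bilinear[OF bounded_bilinear_mult assms])

lemma pd_inner:
  fixes f g :: "real^2 \<Rightarrow> 'b::real_inner"
  assumes "f differentiable (at y)" "g differentiable (at y)"
  shows "pd k (\<lambda>z. f z \<bullet> g z) y = pd k f y \<bullet> g y + f y \<bullet> pd k g y"
  by (rule pd_bounded_bilinear[OF bounded_bilinear_inner assms])

lemma pd_vec_nth: "f differentiable (at y) \<Longrightarrow> pd k (\<lambda>z. f z $ i) y = pd k f y $ i"
  by (rule pd_bounded_linear[OF bounded_linear_vec_nth])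

text \<open>\<open>frechet_derivative\<close> chooses among all derivatives at the point, and
  functions that agree near the point have the same ones; the equality thus covers points without a
  derivative too.\<close>

lemma pd_cong_open:
  assumes "open S" "y \<in> S" "\<And>z. z \<in> S \<Longrightarrow> f z = g z"
  shows "pd k f y = pd k g y"
proof -
  have "(f has_derivative f') (at y) \<longleftrightarrow> (g has_derivative f') (at y)" for f'
    using has_derivative_transform_within_open[OF _ assms(1,2), of f f' UNIV g]
      has_derivative_transform_within_open[OF _ assms(1,2), of g f' UNIV f] assms(3) by auto
  then show ?thesis by (simp only: pd_def frechet_derivative_def)
qed

text \<open>The mean value argument is for real values, hence the passage to components.\<close>

lemma pd_commute:
  fixes f :: "real^2 \<Rightarrow> real^'k::finite"
  assumes "smooth_on S f" "open S" "y \<in> S"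
  shows "pd a (pd b f) y = pd b (pd a f) y"
proof -
  have D: "pd a (pd b f) y $ i = pd a (pd b (\<lambda>z. f z $ i)) y" for a b i
  proof -
    have "pd a (pd b f) y $ i = pd a (\<lambda>z. pd b f z $ i) y"
      by (rule pd_vec_nth[symmetric]) (rule smooth_on_imp_differentiable[OF smooth_on_pd[OF assms(1)] assms(3)])
    also have "\<dots> = pd a (pd b (\<lambda>z. f z $ i)) y"
      by (rule pd_cong_open[OF assms(2,3)]) (rule pd_vec_nth[symmetric], rule smooth_on_imp_differentiable[OF assms(1)])
    finally show ?thesis .
  qed
  have "pd a (pd b (\<lambda>z. f z $ i)) y = pd b (pd a (\<lambda>z. f z $ i)) y" for i
    unfolding pd_def[abs_def]
    by (rule frechet_derivative_commute[OF smooth_on_vec_nth]) (use assms in auto)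
  then show ?thesis by (simp add: vec_eq_iff D)
qed

section \<open>Formal series\<close>

text \<open>\<open>B\<close> is the adjugate, and \<open>e\<close> times it is the inverse. The
  entries will lie in \<open>real poly fps\<close>, where a nonzero determinant does not suffice: it
  has to be a unit.\<close>

lemma invertible_3:
  fixes A :: "'a::comm_ring_1^3^3"
  assumes e: "det A * e = 1"
  shows "invertible A"
proof -
  define B :: "'a^3^3" where "B = vector
    [vector [A$2$2 * A$3$3 - A$2$3 * A$3$2, A$1$3 * A$3$2 - A$1$2 * A$3$3, A$1$2 * A$2$3 - A$1$3 * A$2$2],
     vector [A$2$3 * A$3$1 - A$2$1 * A$3$3, A$1$1 * A$3$3 - A$1$3 * A$3$1, A$1$3 * A$2$1 - A$1$1 * A$2$3],
     vector [A$2$1 * A$3$2 - A$2$2 * A$3$1, A$1$2 * A$3$1 - A$1$1 * A$3$2, A$1$1 * A$2$2 - A$1$2 * A$2$1]]"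
  have B: "B$1$1 = A$2$2 * A$3$3 - A$2$3 * A$3$2" "B$1$2 = A$1$3 * A$3$2 - A$1$2 * A$3$3"
    "B$1$3 = A$1$2 * A$2$3 - A$1$3 * A$2$2" "B$2$1 = A$2$3 * A$3$1 - A$2$1 * A$3$3"
    "B$2$2 = A$1$1 * A$3$3 - A$1$3 * A$3$1" "B$2$3 = A$1$3 * A$2$1 - A$1$1 * A$2$3"
    "B$3$1 = A$2$1 * A$3$2 - A$2$2 * A$3$1" "B$3$2 = A$1$2 * A$3$1 - A$1$1 * A$3$2"
    "B$3$3 = A$1$1 * A$2$2 - A$1$2 * A$2$1"
    unfolding B_def by simp_all
  have "\<forall>i j. (\<Sum>k\<in>UNIV. A $ i $ k * B $ k $ j) = (if i = j then det A else 0)"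
    unfolding forall_3 sum_3 det_3 B by (simp add: algebra_simps)
  moreover have "\<forall>i j. (\<Sum>k\<in>UNIV. B $ i $ k * A $ k $ j) = (if i = j then det A else 0)"
    unfolding forall_3 sum_3 det_3 B by (simp add: algebra_simps)
  ultimately have "(\<Sum>k\<in>UNIV. A $ i $ k * B $ k $ j) * e = (if i = j then 1 else 0)"
    "(\<Sum>k\<in>UNIV. B $ i $ k * A $ k $ j) * e = (if i = j then 1 else 0)" for i j
    using e by simp_all
  then have "(\<Sum>k\<in>UNIV. A $ i $ k * (B $ k $ j * e)) = (if i = j then 1 else 0)"
    "(\<Sum>k\<in>UNIV. (B $ i $ k * e) * A $ k $ j) = (if i = j then 1 else 0)" for i j
    unfolding sum_distrib_right by (simp_all only: mult_ac)
  then have "A ** (\<chi> i j. B $ i $ j * e) = mat 1 \<and> (\<chi> i j. B $ i $ j * e) ** A = mat 1"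
    by (simp only: vec_eq_iff matrix_matrix_mult_def mat_def vec_lambda_beta) blast
  then show ?thesis unfolding invertible_def by blast
qed

lemma matrix_inv_right_comm:
  fixes A :: "'a::comm_ring_1^'n^'n"
  assumes "invertible A"
  shows "A ** matrix_inv A = mat 1"
  using assms unfolding invertible_def matrix_inv_def by (rule someI2_ex) simp

text \<open>Splits the indices of the formal metric into the tangential ones and the normal index
  \<open>3\<close>, so that it can be treated as a 2 by 2 block with a border.\<close>

definition emb3 :: "2 \<Rightarrow> 3" where "emb3 a = (if a = 1 then 1 else 2)"

lemma emb3_neq_3 [simp]: "emb3 a \<noteq> 3" "3 \<noteq> emb3 a"
  by (simp_all add: emb3_def)

lemma emb3_eq_iff [simp]: "emb3 a = emb3 b \<longleftrightarrow> a = b"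
  using exhaust_2[of a] exhaust_2[of b] by (auto simp: emb3_def)

lemma sum_emb3: "sum f (UNIV :: 3 set) = (\<Sum>a\<in>UNIV. f (emb3 a)) + f 3"
  by (simp add: sum_3 sum_2 emb3_def)

lemma formal_D_emb3: "formal_D (emb3 a) F = formal_pd a F"
  using exhaust_2[of a] by (auto simp: formal_D_def emb3_def)

lemma formal_D_3: "formal_D 3 F = formal_dt F"
  by (simp add: formal_D_def)

text \<open>Setting \<open>log t = 0\<close> is a ring homomorphism, so the first coefficients can be compared over the reals.\<close>

definition log_free_coeff :: "nat \<Rightarrow> real poly fps \<Rightarrow> real" where
  "log_free_coeff n F = poly (fps_nth F n) 0"

lemma log_free_coeff_mult:
  "log_free_coeff n (F * G) = (\<Sum>i=0..n. log_free_coeff i F * log_free_coeff (n - i) G)"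
  by (simp add: log_free_coeff_def fps_mult_nth poly_sum)

lemma log_free_coeff_add: "log_free_coeff n (F + G) = log_free_coeff n F + log_free_coeff n G"
  by (simp add: log_free_coeff_def)

lemma log_free_coeff_sum: "log_free_coeff n (\<Sum>i\<in>I. F i) = (\<Sum>i\<in>I. log_free_coeff n (F i))"
  by (simp add: log_free_coeff_def fps_sum_nth poly_sum)

lemma log_free_coeff_if_1: "log_free_coeff n (if P then 1 else 0) = (if P \<and> n = 0 then 1 else 0)"
  by (simp add: log_free_coeff_def)

text \<open>\<open>formal_pd\<close> passes through \<open>Abs_poly\<close>, which needs a sequence
  of finite support. Here the coefficients of positive powers of \<open>log t\<close> vanish for all
  \<open>z\<close>, hence so do their derivatives.\<close>

lemma fps_nth_formal_pd:
  assumes "\<And>z. fps_nth (F z) n = [:f z:]"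
  shows "fps_nth (formal_pd k F y) n = [:pd k f y:]"
proof -
  have "(\<lambda>j. pd k (\<lambda>z. poly.coeff (fps_nth (F z) n) j) y) = poly.coeff [:pd k f y:]"
  proof
    fix j show "pd k (\<lambda>z. poly.coeff (fps_nth (F z) n) j) y = poly.coeff [:pd k f y:] j"
      by (cases j) (simp_all add: assms pd_def)
  qed
  then show ?thesis by (simp add: formal_pd_def coeff_inverse)
qed

text \<open>Degree 1 in \<open>log t\<close> is the largest that occurs up to \<open>t^4\<close>, as
  \<open>(4 - 1) div 3 = 1\<close>.\<close>

lemma fps_nth_formal_dt:
  assumes "fps_nth (F y) (Suc n) = [:a, b:]"
  shows "fps_nth (formal_dt F y) n = [:real (Suc n) * a + b, real (Suc n) * b:]"
proof -
  have "of_nat (Suc n) * [:a, b:] = [:real (Suc n) * a, real (Suc n) * b:]"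
    by (subst of_nat_poly) simp
  then show ?thesis by (simp add: formal_dt_def assms pderiv_pCons del: of_nat_Suc)
qed

section \<open>First coefficients of the ansatz and of its derivatives\<close>

lemma log_ansatz_nth:
  "fps_nth (log_ansatz \<phi> c d s z) 0 = [:\<phi> z $ s:]"
  "fps_nth (log_ansatz \<phi> c d s z) 1 = [:0:]"
  "fps_nth (log_ansatz \<phi> c d s z) 2 = [:c 2 z $ s:]"
  "fps_nth (log_ansatz \<phi> c d s z) 3 = [:c 3 z $ s:]"
  "fps_nth (log_ansatz \<phi> c d s z) 4 = [:d 4 0 z $ s, d 4 1 z $ s:]"
  by (simp_all add: log_ansatz_def monom_Suc monom_0)

lemma log_ansatz_dt_nth:
  "fps_nth (formal_dt (log_ansatz \<phi> c d s) z) 0 = [:0:]"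
  "fps_nth (formal_dt (log_ansatz \<phi> c d s) z) 1 = [:2 * c 2 z $ s:]"
  "fps_nth (formal_dt (log_ansatz \<phi> c d s) z) 2 = [:3 * c 3 z $ s:]"
  "fps_nth (formal_dt (log_ansatz \<phi> c d s) z) 3 = [:4 * d 4 0 z $ s + d 4 1 z $ s, 4 * d 4 1 z $ s:]"
  using fps_nth_formal_dt[of "log_ansatz \<phi> c d s" z 0 0 0] fps_nth_formal_dt[of "log_ansatz \<phi> c d s" z 1 "c 2 z $ s" 0]
    fps_nth_formal_dt[of "log_ansatz \<phi> c d s" z 2 "c 3 z $ s" 0]
    fps_nth_formal_dt[of "log_ansatz \<phi> c d s" z 3 "d 4 0 z $ s" "d 4 1 z $ s"]
  by (simp_all add: log_ansatz_nth[unfolded One_nat_def] numeral_2_eq_2[symmetric])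

lemma log_ansatz_pd_nth:
  "fps_nth (formal_pd k (log_ansatz \<phi> c d s) z) 0 = [:pd k (\<lambda>z. \<phi> z $ s) z:]"
  "fps_nth (formal_pd k (log_ansatz \<phi> c d s) z) 1 = [:0:]"
  "fps_nth (formal_pd k (log_ansatz \<phi> c d s) z) 2 = [:pd k (\<lambda>z. c 2 z $ s) z:]"
  by (subst fps_nth_formal_pd, rule log_ansatz_nth, simp)+

lemma log_ansatz_pd_pd_nth:
  "fps_nth (formal_pd j (formal_pd k (log_ansatz \<phi> c d s)) z) 0 = [:pd j (pd k (\<lambda>z. \<phi> z $ s)) z:]"
  "fps_nth (formal_pd j (formal_pd k (log_ansatz \<phi> c d s)) z) 1 = [:0:]"
  "fps_nth (formal_pd j (formal_pd k (log_ansatz \<phi> c d s)) z) 2 = [:pd j (pd k (\<lambda>z. c 2 z $ s)) z:]"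
  by (subst fps_nth_formal_pd, rule log_ansatz_pd_nth, simp)+

lemma log_ansatz_pd_dt_nth:
  "fps_nth (formal_pd j (formal_dt (log_ansatz \<phi> c d s)) z) 0 = [:0:]"
  "fps_nth (formal_pd j (formal_dt (log_ansatz \<phi> c d s)) z) 1 = [:pd j (\<lambda>z. 2 * c 2 z $ s) z:]"
  by (subst fps_nth_formal_pd, rule log_ansatz_dt_nth, simp)+

lemma log_ansatz_dt_pd_nth:
  "fps_nth (formal_dt (formal_pd j (log_ansatz \<phi> c d s)) z) 0 = [:0:]"
  "fps_nth (formal_dt (formal_pd j (log_ansatz \<phi> c d s)) z) 1 = [:2 * pd j (\<lambda>z. c 2 z $ s) z:]"
  using fps_nth_formal_dt[of "formal_pd j (log_ansatz \<phi> c d s)" z 0 0 0]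
    fps_nth_formal_dt[of "formal_pd j (log_ansatz \<phi> c d s)" z 1 "pd j (\<lambda>z. c 2 z $ s) z" 0]
  by (simp_all add: log_ansatz_pd_nth[unfolded One_nat_def] numeral_2_eq_2[symmetric])

text \<open>The 12 is 4 times 3 and the 7 is 4 plus 3, from
  \<open>(t^4 log t)'' = t^2 (12 log t + 7)\<close>.\<close>

lemma log_ansatz_dt_dt_nth:
  "fps_nth (formal_dt (formal_dt (log_ansatz \<phi> c d s)) z) 0 = [:2 * c 2 z $ s:]"
  "fps_nth (formal_dt (formal_dt (log_ansatz \<phi> c d s)) z) 1 = [:6 * c 3 z $ s:]"
  "fps_nth (formal_dt (formal_dt (log_ansatz \<phi> c d s)) z) 2
     = [:12 * d 4 0 z $ s + 7 * d 4 1 z $ s, 12 * d 4 1 z $ s:]"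
  using fps_nth_formal_dt[of "formal_dt (log_ansatz \<phi> c d s)" z 0 "2 * c 2 z $ s" 0]
    fps_nth_formal_dt[of "formal_dt (log_ansatz \<phi> c d s)" z 1 "3 * c 3 z $ s" 0]
    fps_nth_formal_dt[of "formal_dt (log_ansatz \<phi> c d s)" z 2 "4 * d 4 0 z $ s + d 4 1 z $ s" "4 * d 4 1 z $ s"]
  by (simp_all add: log_ansatz_dt_nth[unfolded One_nat_def] numeral_2_eq_2[symmetric])

text \<open>Serves wherever an unknown is known only through its contraction with a metric: the
  columns of the inverse series, the derivatives of the inverse metric, the sums over a
  frame.\<close>

lemma solve_left_inverse:
  fixes K G :: "'n::finite \<Rightarrow> 'n \<Rightarrow> real"
  assumes KG: "\<And>a b. (\<Sum>e\<in>UNIV. K a e * G e b) = (if a = b then 1 else 0)"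
    and eq: "\<And>a. (\<Sum>b\<in>UNIV. G a b * x b) = v a"
  shows "x a = (\<Sum>b\<in>UNIV. K a b * v b)"
proof -
  have "(\<Sum>b\<in>UNIV. K a b * v b) = (\<Sum>b\<in>UNIV. \<Sum>e\<in>UNIV. K a b * G b e * x e)"
    by (simp add: eq[symmetric] sum_distrib_left mult.assoc)
  also have "\<dots> = (\<Sum>e\<in>UNIV. (\<Sum>b\<in>UNIV. K a b * G b e) * x e)"
    by (subst sum.swap) (simp add: sum_distrib_right)
  also have "\<dots> = (\<Sum>e\<in>UNIV. if a = e then x e else 0)"
    unfolding KG by (rule sum.cong) auto
  also have "\<dots> = x a" by simp
  finally show ?thesis ..
qed

text \<open>For \<open>M = m0 + m1 t + m2 t^2 + ...\<close> the inverse starts with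
  \<open>w0 = m0^-1\<close>, \<open>w1 = - w0 m1 w0\<close>,
  \<open>w2 = w0 (m1 w0 m1 - m2) w0\<close>. Here \<open>m0\<close> and \<open>m1\<close> are block
  diagonal and purely mixed, so \<open>w0\<close> and \<open>w1\<close> are as well. Of order 2 only
  the diagonal blocks are computed: the mixed entries will multiply the \<open>t^0\<close>
  coefficient of the mixed derivatives of \<open>u\<close>, which is 0.\<close>

lemma inverse_expansion_3:
  fixes m w :: "nat \<Rightarrow> 3 \<Rightarrow> 3 \<Rightarrow> real" and K G h :: "2 \<Rightarrow> 2 \<Rightarrow> real" and p :: "2 \<Rightarrow> real"
  assumes KG: "\<And>a b. (\<Sum>e\<in>UNIV. K a e * G e b) = (if a = b then 1 else 0)"
    and mw: "\<And>n i j. (\<Sum>k\<in>UNIV. \<Sum>l=0..n. m l i k * w (n - l) k j) = (if i = j \<and> n = 0 then 1 else 0)"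
    and m0: "\<And>a b. m 0 (emb3 a) (emb3 b) = G a b" "\<And>a. m 0 (emb3 a) 3 = 0" "\<And>a. m 0 3 (emb3 a) = 0" "m 0 3 3 = 1"
    and m1: "\<And>a b. m 1 (emb3 a) (emb3 b) = 0" "\<And>a. m 1 (emb3 a) 3 = p a" "\<And>a. m 1 3 (emb3 a) = p a" "m 1 3 3 = 0"
    and m2: "\<And>a b. m 2 (emb3 a) (emb3 b) = h a b" "m 2 3 3 = q"
  shows "w 0 (emb3 a) (emb3 b) = K a b" "w 0 (emb3 a) 3 = 0" "w 0 3 (emb3 a) = 0" "w 0 3 3 = 1"
    and "w 1 (emb3 a) (emb3 b) = 0" "w 1 (emb3 a) 3 = - (\<Sum>b\<in>UNIV. K a b * p b)"
      "w 1 3 (emb3 a) = - (\<Sum>b\<in>UNIV. p b * K b a)" "w 1 3 3 = 0"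
    and "w 2 (emb3 a) (emb3 b) = (\<Sum>e\<in>UNIV. K a e * (p e * (\<Sum>f\<in>UNIV. p f * K f b) - (\<Sum>f\<in>UNIV. h e f * K f b)))"
      "w 2 3 3 = (\<Sum>a\<in>UNIV. p a * (\<Sum>b\<in>UNIV. K a b * p b)) - q"
proof -
  note solve = solve_left_inverse[OF KG]
  have E0: "(\<Sum>k\<in>UNIV. m 0 i k * w 0 k j) = (if i = j then 1 else 0)" for i j
    using mw[where n=0 and i=i and j=j] by simp
  have E1: "(\<Sum>k\<in>UNIV. m 0 i k * w 1 k j + m 1 i k * w 0 k j) = 0" for i j
    using mw[where n=1 and i=i and j=j] by simp
  have E2: "(\<Sum>k\<in>UNIV. m 0 i k * w 2 k j + m 1 i k * w 1 k j + m 2 i k * w 0 k j) = 0" for i j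
    using mw[where n=2 and i=i and j=j] by (simp add: numeral_2_eq_2)
  have w0K: "w 0 (emb3 a) (emb3 b) = K a b" for a b
    using solve[of "\<lambda>a. w 0 (emb3 a) (emb3 b)" "\<lambda>a. if a = b then 1 else 0" a] E0[of "emb3 e" "emb3 b" for e]
    by (simp add: sum_emb3 m0 if_distrib[of "\<lambda>x. _ * x"] cong: if_cong)
  have w0a3: "w 0 (emb3 a) 3 = 0" for a
    using solve[of "\<lambda>a. w 0 (emb3 a) 3" "\<lambda>a. 0" a] E0[of "emb3 e" 3 for e] by (simp add: sum_emb3 m0)
  have w03a: "w 0 3 (emb3 a) = 0" for a
    using E0[of 3 "emb3 a"] by (simp add: sum_emb3 m0)
  have w033: "w 0 3 3 = 1"
    using E0[of 3 3] by (simp add: sum_emb3 m0)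
  note w0 = w0K w0a3 w03a w033
  have w1ab: "w 1 (emb3 a) (emb3 b) = 0" for a b
    using solve[of "\<lambda>a. w 1 (emb3 a) (emb3 b)" "\<lambda>a. 0" a] E1[of "emb3 e" "emb3 b" for e]
    by (simp add: sum_emb3 m0 m1[unfolded One_nat_def] w0)
  have w1a3: "w 1 (emb3 a) 3 = - (\<Sum>b\<in>UNIV. K a b * p b)" for a
    using solve[of "\<lambda>a. w 1 (emb3 a) 3" "\<lambda>a. - p a" a] E1[of "emb3 e" 3 for e]
    by (simp add: sum_emb3 m0 m1[unfolded One_nat_def] w0 sum_negf eq_neg_iff_add_eq_0)
  have w13a: "w 1 3 (emb3 a) = - (\<Sum>b\<in>UNIV. p b * K b a)" for a
    using E1[of 3 "emb3 a"] by (simp add: sum_emb3 m0 m1[unfolded One_nat_def] w0)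
  have w133: "w 1 3 3 = 0"
    using E1[of 3 3] by (simp add: sum_emb3 m0 m1[unfolded One_nat_def] w0)
  note w1 = w1ab w1a3 w13a w133
  show "w 0 (emb3 a) (emb3 b) = K a b" "w 0 (emb3 a) 3 = 0" "w 0 3 (emb3 a) = 0" "w 0 3 3 = 1"
    by (fact w0)+
  show "w 1 (emb3 a) (emb3 b) = 0" "w 1 (emb3 a) 3 = - (\<Sum>b\<in>UNIV. K a b * p b)"
      "w 1 3 (emb3 a) = - (\<Sum>b\<in>UNIV. p b * K b a)" "w 1 3 3 = 0"
    by (fact w1)+
  show "w 2 (emb3 a) (emb3 b) = (\<Sum>e\<in>UNIV. K a e * (p e * (\<Sum>f\<in>UNIV. p f * K f b) - (\<Sum>f\<in>UNIV. h e f * K f b)))"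
  proof (rule solve)
    fix e show "(\<Sum>a\<in>UNIV. G e a * w 2 (emb3 a) (emb3 b)) = p e * (\<Sum>f\<in>UNIV. p f * K f b) - (\<Sum>f\<in>UNIV. h e f * K f b)"
      using E2[of "emb3 e" "emb3 b"]
      by (simp add: sum_emb3 m0 m1[unfolded One_nat_def] m2 w0 w1[unfolded One_nat_def] sum.distrib)
  qed
  show "w 2 3 3 = (\<Sum>a\<in>UNIV. p a * (\<Sum>b\<in>UNIV. K a b * p b)) - q"
    using E2[of 3 3] by (simp add: sum_emb3 m0 m1[unfolded One_nat_def] m2 w0 w1[unfolded One_nat_def] sum.distrib sum_negf)
qed

text \<open>Division by \<open>t\<close> shifts the index by one, so order \<open>n\<close> of the
  second-order part meets order \<open>n + 1\<close> of the \<open>t\<close>-derivative.\<close>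

lemma log_free_coeff_formal_mss:
  fixes u :: "'k::finite \<Rightarrow> log_series"
  assumes "formal_mss u s y = 0"
  defines "W \<equiv> \<lambda>n i j. log_free_coeff n (matrix_inv (formal_metric u y) $ i $ j)"
  shows "(\<Sum>i\<in>UNIV. \<Sum>j\<in>UNIV. \<Sum>l=0..n. W l i j * log_free_coeff (n - l) (formal_D i (formal_D j (u s)) y))
    = 3 * log_free_coeff (Suc n) (formal_dt (u s) y)"
proof -
  let ?A = "\<Sum>i\<in>UNIV. \<Sum>j\<in>UNIV. matrix_inv (formal_metric u y) $ i $ j * formal_D i (formal_D j (u s)) y"
  have "fls_nth (formal_mss u s y) (int n) = fps_nth ?A n - 3 * fps_nth (formal_dt (u s) y) (Suc n)"
    unfolding formal_mss_def formal_D_3 mult.assoc fls_X_inv_times_conv_shift(1)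
    by (simp add: nat_add_distrib)
  then have "poly (fps_nth ?A n) 0 = poly (3 * fps_nth (formal_dt (u s) y) (Suc n)) 0"
    using assms(1) by simp
  then have "log_free_coeff n ?A = 3 * log_free_coeff (Suc n) (formal_dt (u s) y)"
    by (simp add: log_free_coeff_def)
  then show ?thesis
    by (simp add: log_free_coeff_sum log_free_coeff_mult W_def)
qed

text \<open>Whole polynomials in \<open>log t\<close>, not just their values at 0: the determinant
  is a unit only if its \<open>t^0\<close> coefficient is a nonzero constant polynomial.\<close>

lemma formal_metric_nth_0:
  fixes \<phi> :: "real^2 \<Rightarrow> real^'k::finite" and c :: "nat \<Rightarrow> real^2 \<Rightarrow> real^'k" and d :: "nat \<Rightarrow> nat \<Rightarrow> real^2 \<Rightarrow> real^'k" and y :: "real^2"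
  defines "F \<equiv> \<lambda>a l. pd a (\<lambda>z. \<phi> z $ l) y"
  shows "fps_nth (formal_metric (log_ansatz \<phi> c d) y $ emb3 a $ emb3 b) 0
      = [:(if a = b then 1 else 0) + (\<Sum>l\<in>UNIV. F a l * F b l):]"
    "fps_nth (formal_metric (log_ansatz \<phi> c d) y $ emb3 a $ 3) 0 = 0"
    "fps_nth (formal_metric (log_ansatz \<phi> c d) y $ 3 $ emb3 a) 0 = 0"
    "fps_nth (formal_metric (log_ansatz \<phi> c d) y $ 3 $ 3) 0 = 1"
proof -
  have sum_const: "(\<Sum>l\<in>UNIV. [:f l:]) = [:\<Sum>l\<in>UNIV. f l:]" for f :: "'k \<Rightarrow> real"
    by (rule poly_eqI) (simp add: coeff_sum coeff_pCons split: nat.split)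
  show "fps_nth (formal_metric (log_ansatz \<phi> c d) y $ emb3 a $ emb3 b) 0
      = [:(if a = b then 1 else 0) + (\<Sum>l\<in>UNIV. F a l * F b l):]"
    by (simp add: formal_metric_def formal_D_emb3 fps_sum_nth log_ansatz_pd_nth sum_const F_def one_pCons mult.commute)
qed (simp_all add: formal_metric_def formal_D_emb3 formal_D_3 fps_sum_nth log_ansatz_pd_nth log_ansatz_dt_nth)

text \<open>The tangential derivatives of \<open>u\<close> start with \<open>F + C t^2\<close> and
  the \<open>t\<close>-derivative with \<open>2 c t\<close>. Hence order 1 lives in the border
  alone, and the corner starts with \<open>4 |c|^2 t^2\<close>.\<close>

lemma log_free_coeff_formal_metric:
  fixes \<phi> :: "real^2 \<Rightarrow> real^'k::finite" and c :: "nat \<Rightarrow> real^2 \<Rightarrow> real^'k" and d :: "nat \<Rightarrow> nat \<Rightarrow> real^2 \<Rightarrow> real^'k" and y :: "real^2"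
  defines "F \<equiv> \<lambda>a l. pd a (\<lambda>z. \<phi> z $ l) y" and "C \<equiv> \<lambda>a l. pd a (\<lambda>z. c 2 z $ l) y"
  defines "m \<equiv> \<lambda>n i j. log_free_coeff n (formal_metric (log_ansatz \<phi> c d) y $ i $ j)"
  shows "m 0 (emb3 a) (emb3 b) = (if a = b then 1 else 0) + (\<Sum>l\<in>UNIV. F a l * F b l)"
    "m 0 (emb3 a) 3 = 0" "m 0 3 (emb3 a) = 0" "m 0 3 3 = 1"
    and "m 1 (emb3 a) (emb3 b) = 0" "m 1 (emb3 a) 3 = 2 * (\<Sum>l\<in>UNIV. F a l * c 2 y $ l)"
    "m 1 3 (emb3 a) = 2 * (\<Sum>l\<in>UNIV. F a l * c 2 y $ l)" "m 1 3 3 = 0"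
    and "m 2 (emb3 a) (emb3 b) = (\<Sum>l\<in>UNIV. F a l * C b l + C a l * F b l)"
    "m 2 3 3 = 4 * (\<Sum>l\<in>UNIV. c 2 y $ l * c 2 y $ l)"
proof -
  note [simp] = log_ansatz_pd_nth[unfolded One_nat_def] log_ansatz_dt_nth[unfolded One_nat_def]
  have m: "m n i j = (if i = j \<and> n = 0 then 1 else 0) + (\<Sum>l\<in>UNIV. \<Sum>k=0..n.
      log_free_coeff k (formal_D i (log_ansatz \<phi> c d l) y)
      * log_free_coeff (n - k) (formal_D j (log_ansatz \<phi> c d l) y))" for n i j
    by (simp add: m_def formal_metric_def log_free_coeff_add log_free_coeff_sum log_free_coeff_mult log_free_coeff_if_1)
  have [simp]: "sum f {0..2} = f 0 + f 1 + f 2" for f :: "nat \<Rightarrow> real"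
    by (simp add: numeral_2_eq_2)
  show "m 0 (emb3 a) (emb3 b) = (if a = b then 1 else 0) + (\<Sum>l\<in>UNIV. F a l * F b l)"
    "m 0 (emb3 a) 3 = 0" "m 0 3 (emb3 a) = 0" "m 0 3 3 = 1"
    "m 1 (emb3 a) (emb3 b) = 0" "m 1 (emb3 a) 3 = 2 * (\<Sum>l\<in>UNIV. F a l * c 2 y $ l)"
    "m 1 3 (emb3 a) = 2 * (\<Sum>l\<in>UNIV. F a l * c 2 y $ l)" "m 1 3 3 = 0"
    "m 2 (emb3 a) (emb3 b) = (\<Sum>l\<in>UNIV. F a l * C b l + C a l * F b l)"
    "m 2 3 3 = 4 * (\<Sum>l\<in>UNIV. c 2 y $ l * c 2 y $ l)"
    by (simp_all add: m formal_D_emb3 formal_D_3 log_free_coeff_def F_def C_def sum_distrib_left mult_ac)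
qed

text \<open>At order 0, \<open>2 c\<close> from \<open>u_tt\<close> against \<open>6 c\<close> from
  \<open>3 u_t / t\<close> leaves \<open>4 c\<close>. At order 2,
  \<open>12 d40 + 7 d41 - 3 (4 d40 + d41) = 4 d41\<close>, and the term \<open>6 c3\<close> of
  \<open>u_tt\<close> meets the zero entry \<open>w 1 3 3\<close>. The other summands come from the
  tangential block of order 2, from the two mixed entries of order 1 (the sums \<open>K p\<close>
  and \<open>p K\<close>) times \<open>2 C\<close>, and from \<open>w 2 3 3\<close> times
  \<open>2 c\<close>.\<close>

lemma formal_mss_log_ansatz_eq_0D:
  fixes \<phi> :: "real^2 \<Rightarrow> real^'k::finite" and c :: "nat \<Rightarrow> real^2 \<Rightarrow> real^'k" and d :: "nat \<Rightarrow> nat \<Rightarrow> real^2 \<Rightarrow> real^'k" and y :: "real^2" and K :: "2 \<Rightarrow> 2 \<Rightarrow> real"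
  defines "F \<equiv> \<lambda>a l. pd a (\<lambda>z. \<phi> z $ l) y" and "C \<equiv> \<lambda>a l. pd a (\<lambda>z. c 2 z $ l) y"
  defines "G \<equiv> \<lambda>a b. (if a = b then 1 else 0) + (\<Sum>l\<in>UNIV. F a l * F b l)"
    and "p \<equiv> \<lambda>a. 2 * (\<Sum>l\<in>UNIV. F a l * c 2 y $ l)"
    and "h \<equiv> \<lambda>a b. \<Sum>l\<in>UNIV. F a l * C b l + C a l * F b l"
  assumes mss: "formal_mss (log_ansatz \<phi> c d) s y = 0"
    and KG: "\<And>a b. (\<Sum>e\<in>UNIV. K a e * G e b) = (if a = b then 1 else 0)"
    and det: "G 1 1 * G 2 2 - G 1 2 * G 2 1 \<noteq> 0"
    and diff: "(\<lambda>z. c 2 z $ s) differentiable (at y)"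
  shows "(\<Sum>a\<in>UNIV. \<Sum>b\<in>UNIV. K a b * pd a (pd b (\<lambda>z. \<phi> z $ s)) y) = 4 * c 2 y $ s" (is ?th0)
    and "4 * d 4 1 y $ s + (\<Sum>a\<in>UNIV. \<Sum>b\<in>UNIV. K a b * pd a (pd b (\<lambda>z. c 2 z $ s)) y)
      + (\<Sum>a\<in>UNIV. \<Sum>b\<in>UNIV. (\<Sum>e\<in>UNIV. K a e * (p e * (\<Sum>f\<in>UNIV. p f * K f b) - (\<Sum>f\<in>UNIV. h e f * K f b)))
          * pd a (pd b (\<lambda>z. \<phi> z $ s)) y)
      - 2 * (\<Sum>a\<in>UNIV. ((\<Sum>b\<in>UNIV. K a b * p b) + (\<Sum>b\<in>UNIV. p b * K b a)) * C a s)
      + 2 * ((\<Sum>a\<in>UNIV. p a * (\<Sum>b\<in>UNIV. K a b * p b)) - 4 * (\<Sum>l\<in>UNIV. c 2 y $ l * c 2 y $ l)) * c 2 y $ s = 0" (is ?th2)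
proof -
  define M where "M = formal_metric (log_ansatz \<phi> c d) y"
  define m where "m = (\<lambda>n i j. log_free_coeff n (M $ i $ j))"
  define w where "w = (\<lambda>n i j. log_free_coeff n (matrix_inv M $ i $ j))"
  have "fps_nth (det M) 0 = [:G 1 1 * G 2 2 - G 1 2 * G 2 1:]"
    using formal_metric_nth_0[of \<phi> c d y] formal_metric_nth_0(1)[of \<phi> c d y 1 1] formal_metric_nth_0(1)[of \<phi> c d y 1 2]
      formal_metric_nth_0(1)[of \<phi> c d y 2 1] formal_metric_nth_0(1)[of \<phi> c d y 2 2]
      formal_metric_nth_0(2)[of \<phi> c d y 1] formal_metric_nth_0(2)[of \<phi> c d y 2]
    by (simp add: det_3 M_def emb3_def G_def F_def)
  \<comment> \<open>A power series is a unit once its constant coefficient is one; here that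
    coefficient is a nonzero constant of \<open>real poly\<close>.\<close>
  then have "fps_nth (det M) 0 * [:inverse (G 1 1 * G 2 2 - G 1 2 * G 2 1):] = 1"
    using det by (simp add: one_pCons)
  then have "invertible M"
    by (rule invertible_3[OF fps_right_inverse])
  then have "(M ** matrix_inv M) $ i $ j = (if i = j then 1 else 0)" for i j
    by (simp add: matrix_inv_right_comm mat_def)
  then have "log_free_coeff n (\<Sum>k\<in>UNIV. M $ i $ k * matrix_inv M $ k $ j) = (if i = j \<and> n = 0 then 1 else 0)" for n i j
    by (simp add: matrix_matrix_mult_def log_free_coeff_if_1)
  then have mw: "(\<Sum>k\<in>UNIV. \<Sum>l=0..n. m l i k * w (n - l) k j) = (if i = j \<and> n = 0 then 1 else 0)" for n i j
    by (simp add: log_free_coeff_sum log_free_coeff_mult w_def m_def)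
  have m: "m 0 (emb3 a) (emb3 b) = G a b" "m 0 (emb3 a) 3 = 0" "m 0 3 (emb3 a) = 0" "m 0 3 3 = 1"
    "m 1 (emb3 a) (emb3 b) = 0" "m 1 (emb3 a) 3 = p a" "m 1 3 (emb3 a) = p a" "m 1 3 3 = 0"
    "m 2 (emb3 a) (emb3 b) = h a b" "m 2 3 3 = 4 * (\<Sum>l\<in>UNIV. c 2 y $ l * c 2 y $ l)" for a b
    unfolding m_def M_def G_def p_def h_def F_def C_def by (rule log_free_coeff_formal_metric)+
  note w = inverse_expansion_3[where m = m and w = w, OF KG mw m]
  have [simp]: "sum f {0..2} = f 0 + f 1 + f 2" for f :: "nat \<Rightarrow> real"
    by (simp add: numeral_2_eq_2)
  have pd2: "pd a (\<lambda>z. 2 * c 2 z $ s) y = 2 * C a s" for a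
    unfolding C_def by (rule pd_bounded_linear[OF bounded_linear_mult_right diff])
  have eq: "(\<Sum>i\<in>UNIV. \<Sum>j\<in>UNIV. \<Sum>l=0..n. w l i j * log_free_coeff (n - l) (formal_D i (formal_D j (log_ansatz \<phi> c d s)) y))
      = 3 * log_free_coeff (Suc n) (formal_dt (log_ansatz \<phi> c d s) y)" for n
    unfolding w_def M_def by (rule log_free_coeff_formal_mss[OF mss])
  have coeffs: "log_free_coeff 0 (formal_pd a (formal_pd b (log_ansatz \<phi> c d s)) y) = pd a (pd b (\<lambda>z. \<phi> z $ s)) y"
    "log_free_coeff 2 (formal_pd a (formal_pd b (log_ansatz \<phi> c d s)) y) = pd a (pd b (\<lambda>z. c 2 z $ s)) y"
    "log_free_coeff 0 (formal_pd a (formal_dt (log_ansatz \<phi> c d s)) y) = 0"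
    "log_free_coeff (Suc 0) (formal_pd a (formal_dt (log_ansatz \<phi> c d s)) y) = 2 * C a s"
    "log_free_coeff 0 (formal_dt (formal_pd a (log_ansatz \<phi> c d s)) y) = 0"
    "log_free_coeff (Suc 0) (formal_dt (formal_pd a (log_ansatz \<phi> c d s)) y) = 2 * C a s"
    "log_free_coeff 0 (formal_dt (formal_dt (log_ansatz \<phi> c d s)) y) = 2 * c 2 y $ s"
    "log_free_coeff 2 (formal_dt (formal_dt (log_ansatz \<phi> c d s)) y) = 12 * d 4 0 y $ s + 7 * d 4 1 y $ s"
    "log_free_coeff (Suc 0) (formal_dt (log_ansatz \<phi> c d s) y) = 2 * c 2 y $ s"
    "log_free_coeff 3 (formal_dt (log_ansatz \<phi> c d s) y) = 4 * d 4 0 y $ s + d 4 1 y $ s" for a b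
    by (simp_all add: log_free_coeff_def log_ansatz_pd_pd_nth log_ansatz_pd_dt_nth[unfolded One_nat_def]
      log_ansatz_dt_pd_nth[unfolded One_nat_def] log_ansatz_dt_dt_nth log_ansatz_dt_nth[unfolded One_nat_def] pd2[simplified] C_def)
  show ?th0
    using eq[of 0] by (simp add: sum_emb3 w formal_D_emb3 formal_D_3 coeffs sum.distrib)
  show ?th2
    using eq[of 2] by (simp add: sum_emb3 w[unfolded One_nat_def] formal_D_emb3 formal_D_3 coeffs sum_2 algebra_simps)
qed

section \<open>The graph as a submanifold\<close>

lemma frechet_derivative_eq_sum_pd:
  assumes "f differentiable (at y)"
  shows "frechet_derivative f (at y) v = (\<Sum>a\<in>UNIV. v $ a *\<^sub>R pd a f y)"
proof -
  have v: "(\<Sum>a\<in>UNIV. v $ a *\<^sub>R axis a 1) = v"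
    using basis_expansion[of v] by (simp add: scalar_mult_eq_scaleR)
  have "frechet_derivative f (at y) (\<Sum>a\<in>UNIV. v $ a *\<^sub>R axis a 1) = (\<Sum>a\<in>UNIV. v $ a *\<^sub>R pd a f y)"
    using linear_frechet_derivative[OF assms] by (simp add: linear_sum linear_scale pd_def)
  then show ?thesis by (simp only: v)
qed

definition coord_tangent :: "(real^2 \<Rightarrow> real^'k::finite) \<Rightarrow> real^2 \<Rightarrow> 2 \<Rightarrow> (real^2) \<times> (real^'k)" where
  "coord_tangent \<phi> y a = (axis a 1, pd a \<phi> y)"

definition inverse_metric :: "(real^2 \<Rightarrow> real^'k::finite) \<Rightarrow> real^2 \<Rightarrow> 2 \<Rightarrow> 2 \<Rightarrow> real" where
  "inverse_metric \<phi> y a b = matrix_inv (graph_metric \<phi> y) $ a $ b"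

lemma has_derivative_graph_map:
  assumes "\<phi> differentiable (at y)"
  shows "(graph_map \<phi> has_derivative (\<lambda>v. (v, frechet_derivative \<phi> (at y) v))) (at y)"
  unfolding graph_map_def[abs_def]
  by (intro has_derivative_Pair has_derivative_ident has_derivative_frechet assms)

lemma frechet_derivative_graph_map:
  assumes "\<phi> differentiable (at y)"
  shows "frechet_derivative (graph_map \<phi>) (at y) v = (v, frechet_derivative \<phi> (at y) v)"
  using frechet_derivative_at[OF has_derivative_graph_map[OF assms]] by metis

lemma pd_graph_map: "\<phi> differentiable (at y) \<Longrightarrow> pd a (graph_map \<phi>) y = coord_tangent \<phi> y a"
  by (simp add: pd_def[of a "graph_map \<phi>"] frechet_derivative_graph_map coord_tangent_def pd_def)

lemma frechet_derivative_graph_map_eq_sum: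
  assumes "\<phi> differentiable (at y)"
  shows "frechet_derivative (graph_map \<phi>) (at y) v = (\<Sum>a\<in>UNIV. v $ a *\<^sub>R coord_tangent \<phi> y a)"
  using frechet_derivative_eq_sum_pd[of "graph_map \<phi>" y v] has_derivative_graph_map[OF assms]
  by (simp add: pd_graph_map[OF assms] differentiableI)

text \<open>A tangent vector of a graph is determined by its first component, whose entries are its
  coordinates in the basis \<open>coord_tangent\<close>.\<close>

lemma tangent_space_iff:
  assumes "\<phi> differentiable (at y)"
  shows "t \<in> tangent_space \<phi> y \<longleftrightarrow> t = (\<Sum>a\<in>UNIV. fst t $ a *\<^sub>R coord_tangent \<phi> y a)"
proof
  assume "t \<in> tangent_space \<phi> y"
  then obtain v where v: "t = frechet_derivative (graph_map \<phi>) (at y) v"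
    by (auto simp: tangent_space_def)
  then have "fst t = v" using frechet_derivative_graph_map[OF assms] by simp
  then show "t = (\<Sum>a\<in>UNIV. fst t $ a *\<^sub>R coord_tangent \<phi> y a)"
    using v frechet_derivative_graph_map_eq_sum[OF assms, of v] by simp
next
  assume "t = (\<Sum>a\<in>UNIV. fst t $ a *\<^sub>R coord_tangent \<phi> y a)"
  then show "t \<in> tangent_space \<phi> y"
    unfolding tangent_space_def using frechet_derivative_graph_map_eq_sum[OF assms, of "fst t"] by (metis rangeI)
qed

lemma subspace_tangent_space:
  assumes "\<phi> differentiable (at y)"
  shows "subspace (tangent_space \<phi> y)"
proof -
  have "frechet_derivative (graph_map \<phi>) (at y) = (\<lambda>v. (v, frechet_derivative \<phi> (at y) v))"
    using frechet_derivative_graph_map[OF assms] by auto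
  then have "linear (frechet_derivative (graph_map \<phi>) (at y))"
    using has_derivative_graph_map[OF assms] has_derivative_linear by metis
  then show ?thesis
    unfolding tangent_space_def by (rule linear_subspace_image[OF _ subspace_UNIV])
qed

lemma coord_tangent_in_tangent_space:
  assumes "\<phi> differentiable (at y)"
  shows "coord_tangent \<phi> y a \<in> tangent_space \<phi> y"
  unfolding tangent_space_iff[OF assms]
  using exhaust_2[of a] by (auto simp: coord_tangent_def axis_def sum_2)

lemma inner_tangent_space_eq_0:
  assumes "\<phi> differentiable (at y)" "t \<in> tangent_space \<phi> y" "\<And>a. w \<bullet> coord_tangent \<phi> y a = 0"
  shows "w \<bullet> t = 0"
  using arg_cong[OF assms(2)[unfolded tangent_space_iff[OF assms(1)]], of "\<lambda>t. w \<bullet> t"]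
  by (simp add: inner_sum_right assms(3))

lemma graph_metric_nth:
  assumes "\<phi> differentiable (at y)"
  shows "graph_metric \<phi> y $ a $ b = (if a = b then 1 else 0) + pd a \<phi> y \<bullet> pd b \<phi> y"
  by (simp add: graph_metric_def pd_graph_map[OF assms] coord_tangent_def inner_axis_axis)

lemma graph_metric_eq_inner:
  assumes "\<phi> differentiable (at y)"
  shows "graph_metric \<phi> y $ a $ b = coord_tangent \<phi> y a \<bullet> coord_tangent \<phi> y b"
  by (simp add: graph_metric_def pd_graph_map[OF assms])

text \<open>With \<open>a\<close>, \<open>b\<close> the two derivatives of \<open>\<phi>\<close>,
  the determinant is \<open>1 + |a|^2 + |b|^2\<close> plus the Cauchy-Schwarz defect of
  \<open>a\<close> and \<open>b\<close>.\<close>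

lemma det_graph_metric_pos:
  assumes "\<phi> differentiable (at y)"
  shows "det (graph_metric \<phi> y) > 0"
proof -
  let ?a = "pd 1 \<phi> y" and ?b = "pd 2 \<phi> y"
  have "(?a \<bullet> ?b)\<^sup>2 \<le> (?a \<bullet> ?a) * (?b \<bullet> ?b)"
    by (rule Cauchy_Schwarz_ineq)
  moreover have "?a \<bullet> ?a \<ge> 0" "?b \<bullet> ?b \<ge> 0" by simp_all
  ultimately have "0 < 1 + ?a \<bullet> ?a + ?b \<bullet> ?b + (?a \<bullet> ?a) * (?b \<bullet> ?b) - (?a \<bullet> ?b)\<^sup>2"
    by linarith
  then show ?thesis
    by (simp add: det_2 graph_metric_nth[OF assms] algebra_simps power2_eq_square inner_commute)
qed

lemma graph_metric_sym: "graph_metric \<phi> y $ a $ b = graph_metric \<phi> y $ b $ a"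
  by (simp add: graph_metric_def inner_commute)

lemma
  assumes "\<phi> differentiable (at y)"
  shows inverse_metric_mult_left:
      "(\<Sum>e\<in>UNIV. inverse_metric \<phi> y a e * graph_metric \<phi> y $ e $ b) = (if a = b then 1 else 0)"
    and inverse_metric_mult_right:
      "(\<Sum>e\<in>UNIV. graph_metric \<phi> y $ a $ e * inverse_metric \<phi> y e b) = (if a = b then 1 else 0)"
proof -
  have "invertible (graph_metric \<phi> y)"
    using det_graph_metric_pos[OF assms] by (simp add: invertible_det_nz)
  then have "graph_metric \<phi> y ** matrix_inv (graph_metric \<phi> y) = mat 1"
    by (rule matrix_inv_right_comm)
  moreover from this have "matrix_inv (graph_metric \<phi> y) ** graph_metric \<phi> y = mat 1"
    by (simp add: matrix_left_right_inverse)
  ultimately show "(\<Sum>e\<in>UNIV. inverse_metric \<phi> y a e * graph_metric \<phi> y $ e $ b) = (if a = b then 1 else 0)"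
    "(\<Sum>e\<in>UNIV. graph_metric \<phi> y $ a $ e * inverse_metric \<phi> y e b) = (if a = b then 1 else 0)"
    by (simp_all add: vec_eq_iff matrix_matrix_mult_def mat_def inverse_metric_def)
qed

lemma cramer_symmetric_2:
  fixes g11 g12 g22 k1 k2 u v :: real
  assumes "k1 * g11 + k2 * g12 = u" "k1 * g12 + k2 * g22 = v"
  shows "k1 * (g11 * g22 - g12 * g12) = u * g22 - v * g12"
    "k2 * (g11 * g22 - g12 * g12) = v * g11 - u * g12"
  by (simp_all add: algebra_simps flip: assms)

text \<open>Quotients by the determinant yield both the symmetry and the smoothness of the inverse
  metric.\<close>

lemma inverse_metric_explicit:
  assumes "\<phi> differentiable (at y)"
  shows "inverse_metric \<phi> y 1 1 = graph_metric \<phi> y $ 2 $ 2 / det (graph_metric \<phi> y)"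
    "inverse_metric \<phi> y 1 2 = - graph_metric \<phi> y $ 1 $ 2 / det (graph_metric \<phi> y)"
    "inverse_metric \<phi> y 2 1 = - graph_metric \<phi> y $ 1 $ 2 / det (graph_metric \<phi> y)"
    "inverse_metric \<phi> y 2 2 = graph_metric \<phi> y $ 1 $ 1 / det (graph_metric \<phi> y)"
proof -
  note D = det_graph_metric_pos[OF assms]
  note I = inverse_metric_mult_left[OF assms, unfolded sum_2]
  have [simp]: "graph_metric \<phi> y $ 2 $ 1 = graph_metric \<phi> y $ 1 $ 2" by (rule graph_metric_sym)
  have det: "det (graph_metric \<phi> y) = graph_metric \<phi> y $ 1 $ 1 * graph_metric \<phi> y $ 2 $ 2 - graph_metric \<phi> y $ 1 $ 2 * graph_metric \<phi> y $ 1 $ 2"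
    by (simp add: det_2)
  note C = cramer_symmetric_2[of "inverse_metric \<phi> y a 1" "graph_metric \<phi> y $ 1 $ 1" "inverse_metric \<phi> y a 2"
      "graph_metric \<phi> y $ 1 $ 2" _ "graph_metric \<phi> y $ 2 $ 2" for a, folded det]
  show "inverse_metric \<phi> y 1 1 = graph_metric \<phi> y $ 2 $ 2 / det (graph_metric \<phi> y)"
    "inverse_metric \<phi> y 1 2 = - graph_metric \<phi> y $ 1 $ 2 / det (graph_metric \<phi> y)"
    "inverse_metric \<phi> y 2 1 = - graph_metric \<phi> y $ 1 $ 2 / det (graph_metric \<phi> y)"
    "inverse_metric \<phi> y 2 2 = graph_metric \<phi> y $ 1 $ 1 / det (graph_metric \<phi> y)"
    using D C[of 1 1 0] C[of 2 0 1] I[of 1 1] I[of 1 2] I[of 2 1] I[of 2 2] by (simp_all add: field_simps)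
qed

lemma inverse_metric_sym:
  assumes "\<phi> differentiable (at y)"
  shows "inverse_metric \<phi> y a b = inverse_metric \<phi> y b a"
  using exhaust_2[of a] exhaust_2[of b] inverse_metric_explicit[OF assms] by auto

text \<open>\<open>normal_proj\<close> is a definite description. Existence: removing the vector
  \<open>t\<close> with coefficients \<open>g^ab (v . X_b)\<close> leaves something orthogonal to
  every \<open>X_e\<close>. Uniqueness: two candidates differ by a vector both tangent and normal,
  hence by 0.\<close>

lemma
  assumes "\<phi> differentiable (at y)"
  shows normal_proj_eq: "normal_proj \<phi> y v
      = v - (\<Sum>a\<in>UNIV. (\<Sum>b\<in>UNIV. inverse_metric \<phi> y a b * (v \<bullet> coord_tangent \<phi> y b)) *\<^sub>R coord_tangent \<phi> y a)"
    and normal_proj_orthogonal: "normal_proj \<phi> y v \<bullet> coord_tangent \<phi> y e = 0"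
proof -
  let ?X = "coord_tangent \<phi> y" and ?T = "tangent_space \<phi> y"
  define t where "t = (\<Sum>a\<in>UNIV. (\<Sum>b\<in>UNIV. inverse_metric \<phi> y a b * (v \<bullet> ?X b)) *\<^sub>R ?X a)"
  note T = subspace_tangent_space[OF assms] and XT = coord_tangent_in_tangent_space[OF assms]
  have tT: "t \<in> ?T"
    unfolding t_def by (intro subspace_sum[OF T] subspace_scale[OF T] XT)
  have orth: "(v - t) \<bullet> ?X e = 0" for e
  proof -
    have "t \<bullet> ?X e = (\<Sum>b\<in>UNIV. (\<Sum>a\<in>UNIV. graph_metric \<phi> y $ e $ a * inverse_metric \<phi> y a b) * (v \<bullet> ?X b))"
      by (simp add: t_def inner_sum_left sum_2 graph_metric_eq_inner[OF assms] inner_commute algebra_simps)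
    also have "\<dots> = v \<bullet> ?X e"
      unfolding inverse_metric_mult_right[OF assms] by (simp add: if_distrib[of "\<lambda>x. x * _"] cong: if_cong)
    finally show ?thesis by (simp add: inner_diff_left)
  qed
  have uniq: "w = v - t" if w: "w \<in> orthogonal_comp ?T" "v - w \<in> ?T" for w
  proof -
    have "t - (v - w) \<in> ?T"
      by (rule subspace_diff[OF T tT w(2)])
    then have zT: "w - (v - t) \<in> ?T" by (simp add: algebra_simps)
    have "(w - (v - t)) \<bullet> ?X e = 0" for e
      using w(1) XT[of e] orth[of e]
      by (auto simp: orthogonal_comp_def orthogonal_def inner_diff_left[of w] inner_commute[of w])
    from inner_tangent_space_eq_0[OF assms zT this] show ?thesis by simp
  qed
  have orthc: "v - t \<in> orthogonal_comp ?T"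
    using inner_tangent_space_eq_0[OF assms _ orth] by (auto simp: orthogonal_comp_def orthogonal_def inner_commute)
  have eq: "normal_proj \<phi> y v = v - t"
    unfolding normal_proj_def
  proof (rule the_equality)
    show "v - t \<in> orthogonal_comp ?T \<and> v - (v - t) \<in> ?T"
      using orthc tT by simp
  qed (use uniq in blast)
  then show "normal_proj \<phi> y v
      = v - (\<Sum>a\<in>UNIV. (\<Sum>b\<in>UNIV. inverse_metric \<phi> y a b * (v \<bullet> ?X b)) *\<^sub>R ?X a)"
    by (simp only: t_def)
  show "normal_proj \<phi> y v \<bullet> coord_tangent \<phi> y e = 0"
    unfolding eq by (rule orth)
qed

lemma linear_normal_proj:
  assumes "\<phi> differentiable (at y)"
  shows "linear (normal_proj \<phi> y)"
  by (rule linearI)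
    (simp_all add: normal_proj_eq[OF assms] inner_add_left distrib_left sum.distrib scaleR_add_left
      scaleR_diff_right scaleR_sum_right sum_distrib_left mult_ac)

lemma tangent_frame:
  assumes "\<phi> differentiable (at y)"
  shows "pairwise orthogonal (tangent_frame \<phi> y)" "\<And>e. e \<in> tangent_frame \<phi> y \<Longrightarrow> norm e = 1"
    "span (tangent_frame \<phi> y) = tangent_space \<phi> y" "finite (tangent_frame \<phi> y)"
proof -
  let ?B = "tangent_frame \<phi> y"
  have "\<exists>B. pairwise orthogonal B \<and> (\<forall>e\<in>B. norm e = 1) \<and> span B = tangent_space \<phi> y"
    using orthonormal_basis_subspace[OF subspace_tangent_space[OF assms]] by metis
  then have B: "pairwise orthogonal ?B \<and> (\<forall>e\<in>?B. norm e = 1) \<and> span ?B = tangent_space \<phi> y"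
    unfolding tangent_frame_def by (rule someI_ex)
  then show "pairwise orthogonal ?B" "\<And>e. e \<in> ?B \<Longrightarrow> norm e = 1" "span ?B = tangent_space \<phi> y"
    by auto
  then have "independent ?B"
    using pairwise_orthogonal_independent norm_zero zero_neq_one by metis
  then show "finite ?B" by (rule independent_imp_finite)
qed

text \<open>Expanding \<open>X_c\<close> in the orthonormal frame shows that the metric times the
  frame sum is the identity. This makes traces over the chosen frame contractions with the inverse
  metric.\<close>

lemma sum_tangent_frame:
  assumes "\<phi> differentiable (at y)"
  shows "(\<Sum>e\<in>tangent_frame \<phi> y. fst e $ a * fst e $ b) = inverse_metric \<phi> y a b"
proof -
  let ?B = "tangent_frame \<phi> y" and ?X = "coord_tangent \<phi> y"
  note B = tangent_frame[OF assms]
  have "(\<Sum>e'\<in>UNIV. graph_metric \<phi> y $ c $ e' * (\<Sum>e\<in>?B. fst e $ e' * fst e $ b)) = (if c = b then 1 else 0)" for c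
  proof -
    have e: "(\<Sum>e'\<in>UNIV. graph_metric \<phi> y $ c $ e' * fst e $ e') = ?X c \<bullet> e" if "e \<in> ?B" for e
    proof -
      have "e \<in> tangent_space \<phi> y"
        using span_base[OF that] B(3) by simp
      from arg_cong[OF this[unfolded tangent_space_iff[OF assms]], of "\<lambda>e. ?X c \<bullet> e"]
      show ?thesis by (simp add: inner_sum_right graph_metric_eq_inner[OF assms] mult.commute)
    qed
    have "(\<Sum>e'\<in>UNIV. graph_metric \<phi> y $ c $ e' * (\<Sum>e\<in>?B. fst e $ e' * fst e $ b))
      = (\<Sum>e\<in>?B. (\<Sum>e'\<in>UNIV. graph_metric \<phi> y $ c $ e' * fst e $ e') * fst e $ b)"
      by (simp add: sum_2 sum_distrib_left sum.distrib[symmetric] algebra_simps)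
    also have "\<dots> = (\<Sum>e\<in>?B. (?X c \<bullet> e) * fst e $ b)"
      using e by (intro sum.cong) auto
    also have "\<dots> = fst (\<Sum>e\<in>?B. (?X c \<bullet> e) *\<^sub>R e) $ b"
      by (simp add: fst_sum)
    also have "(\<Sum>e\<in>?B. (?X c \<bullet> e) *\<^sub>R e) = ?X c"
      using orthonormal_basis_expand[OF B(1) B(2) _ B(4), of "?X c"] coord_tangent_in_tangent_space[OF assms]
      by (simp add: B(3))
    finally show ?thesis by (auto simp: coord_tangent_def axis_def)
  qed
  from solve_left_inverse[where K = "inverse_metric \<phi> y", OF inverse_metric_mult_left[OF assms] this]
  show ?thesis by (simp add: if_distrib[of "\<lambda>x. _ * x"] cong: if_cong)
qed

text \<open>The second fundamental form on coordinate vectors: the second derivatives of the graph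
  map have first component 0.\<close>

definition coord_second_ff :: "(real^2 \<Rightarrow> real^'k::finite) \<Rightarrow> real^2 \<Rightarrow> 2 \<Rightarrow> 2 \<Rightarrow> (real^2) \<times> (real^'k)" where
  "coord_second_ff \<phi> y a b = normal_proj \<phi> y (0, pd a (pd b \<phi>) y)"

text \<open>The extension of \<open>w\<close> has the constant first component \<open>fst w\<close>,
  so its derivative is a combination of the vectors
  \<open>(0, pd a (pd b \<phi>) y)\<close>.\<close>

lemma second_ff_eq:
  assumes "smooth_on S \<phi>" "open S" "y \<in> S"
  shows "second_ff \<phi> y v w
    = (\<Sum>a\<in>UNIV. \<Sum>b\<in>UNIV. (fst v $ a * fst w $ b) *\<^sub>R coord_second_ff \<phi> y a b)"
proof -
  have d: "\<phi> differentiable (at z)" if "z \<in> S" for z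
    using smooth_on_imp_differentiable assms(1) that .
  have d2: "pd b \<phi> differentiable (at y)" for b
    using smooth_on_imp_differentiable smooth_on_pd assms(1,3) by blast
  have "((\<lambda>z. (fst w, \<Sum>b\<in>UNIV. fst w $ b *\<^sub>R pd b \<phi> z)) has_derivative
      (\<lambda>u. (0, \<Sum>b\<in>UNIV. fst w $ b *\<^sub>R frechet_derivative (pd b \<phi>) (at y) u))) (at y)"
    by (intro has_derivative_Pair has_derivative_const has_derivative_sum has_derivative_scaleR_right has_derivative_frechet d2)
  then have "((\<lambda>z. frechet_derivative (graph_map \<phi>) (at z) (fst w)) has_derivative
      (\<lambda>u. (0, \<Sum>b\<in>UNIV. fst w $ b *\<^sub>R frechet_derivative (pd b \<phi>) (at y) u))) (at y)"
    by (rule has_derivative_transform_within_open[OF _ assms(2,3)])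
      (simp add: frechet_derivative_graph_map[OF d] frechet_derivative_eq_sum_pd[OF d])
  then have "frechet_derivative (\<lambda>z. frechet_derivative (graph_map \<phi>) (at z) (fst w)) (at y) (fst v)
    = (0, \<Sum>b\<in>UNIV. fst w $ b *\<^sub>R frechet_derivative (pd b \<phi>) (at y) (fst v))"
    by (rule fun_cong[OF frechet_derivative_at[symmetric]])
  also have "\<dots> = (\<Sum>a\<in>UNIV. \<Sum>b\<in>UNIV. (fst v $ a * fst w $ b) *\<^sub>R (0, pd a (pd b \<phi>) y))"
    by (simp add: frechet_derivative_eq_sum_pd[OF d2] sum_2 algebra_simps)
  moreover have "normal_proj \<phi> y (0, r *\<^sub>R x) = r *\<^sub>R normal_proj \<phi> y (0, x)" for r x
    using linear_scale[OF linear_normal_proj[OF d[OF assms(3)]], of r "(0, x)"] by simp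
  ultimately show ?thesis
    using linear_normal_proj[OF d[OF assms(3)]]
    by (simp add: second_ff_def coord_second_ff_def linear_sum linear_scale)
qed

lemma mean_curvature_eq:
  assumes "smooth_on S \<phi>" "open S" "y \<in> S"
  shows "mean_curvature \<phi> y = (1 / 2) *\<^sub>R (\<Sum>a\<in>UNIV. \<Sum>b\<in>UNIV. inverse_metric \<phi> y a b *\<^sub>R coord_second_ff \<phi> y a b)"
proof -
  have d: "\<phi> differentiable (at y)"
    using smooth_on_imp_differentiable assms(1,3) .
  show ?thesis
    unfolding mean_curvature_def second_ff_eq[OF assms] sum_tangent_frame[OF d, symmetric]
    by (simp only: sum_2 sum.distrib scaleR_left.sum)
qed

text \<open>In coordinates every summand is a product of a factor in \<open>e\<close> and a factor
  in \<open>e'\<close>; the double sum over the frame then splits, and each factor is an entry of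
  the inverse metric.\<close>

lemma Q_II_eq:
  fixes \<phi> :: "real^2 \<Rightarrow> real^'k::finite"
  assumes "smooth_on S \<phi>" "open S" "y \<in> S"
  shows "Q_II \<phi> y V = (\<Sum>a\<in>UNIV. \<Sum>b\<in>UNIV. \<Sum>c\<in>UNIV. \<Sum>d\<in>UNIV.
     (inverse_metric \<phi> y a c * inverse_metric \<phi> y b d * (V \<bullet> coord_second_ff \<phi> y a b)) *\<^sub>R coord_second_ff \<phi> y c d)"
proof -
  have d: "\<phi> differentiable (at y)"
    using smooth_on_imp_differentiable assms(1,3) .
  let ?B = "tangent_frame \<phi> y" and ?C = "coord_second_ff \<phi> y"
  have "(V \<bullet> second_ff \<phi> y e e') *\<^sub>R second_ff \<phi> y e e'
     = (\<Sum>a\<in>UNIV. \<Sum>b\<in>UNIV. \<Sum>c\<in>UNIV. \<Sum>d\<in>UNIV. ((fst e $ a * fst e $ c) * ((fst e' $ b * fst e' $ d) * (V \<bullet> ?C a b))) *\<^sub>R ?C c d)" for e e'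
    unfolding second_ff_eq[OF assms] by (simp add: sum_2 algebra_simps inner_add_right)
  moreover have pull: "(\<Sum>e\<in>?B. \<Sum>e'\<in>?B. (f e * (g e' * k)) *\<^sub>R w) = ((\<Sum>e\<in>?B. f e) * ((\<Sum>e'\<in>?B. g e') * k)) *\<^sub>R w"
    for f g :: "(real^2) \<times> (real^'k) \<Rightarrow> real" and k and w :: "(real^2) \<times> (real^'k)"
    by (simp only: sum_distrib_right[of g] sum_product scaleR_left.sum)
  ultimately have "Q_II \<phi> y V = (\<Sum>e\<in>?B. \<Sum>e'\<in>?B. \<Sum>a\<in>UNIV. \<Sum>b\<in>UNIV. \<Sum>c\<in>UNIV. \<Sum>d\<in>UNIV.
       ((fst e $ a * fst e $ c) * ((fst e' $ b * fst e' $ d) * (V \<bullet> ?C a b))) *\<^sub>R ?C c d)"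
    by (simp add: Q_II_def)
  also have "\<dots> = (\<Sum>a\<in>UNIV. \<Sum>b\<in>UNIV. \<Sum>c\<in>UNIV. \<Sum>d\<in>UNIV.
       ((\<Sum>e\<in>?B. fst e $ a * fst e $ c) * ((\<Sum>e'\<in>?B. fst e' $ b * fst e' $ d) * (V \<bullet> ?C a b))) *\<^sub>R ?C c d)"
    by (simp only: sum_2 sum.distrib pull)
  finally show ?thesis by (simp add: sum_tangent_frame[OF d] mult.assoc)
qed

section \<open>Laplacian of the mean curvature\<close>

lemma pd_sqrt:
  assumes "f differentiable (at y)" "f y > 0"
  shows "pd k (\<lambda>z. sqrt (f z)) y = pd k f y / (2 * sqrt (f y))"
  using pd_eqI[OF has_derivative_real_sqrt[OF assms(2) has_derivative_frechet[OF assms(1)]], of k]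
  by (simp only: pd_def divide_inverse inverse_mult_distrib mult_ac)

text \<open>The coefficients \<open>p\<^sup>a\<close> of \<open>H = 2 (0, c) - p\<^sup>a \<partial>\<^sub>aX\<close>.\<close>

definition shift_coeff :: "(real^2 \<Rightarrow> real^'k::finite) \<Rightarrow> (real^2 \<Rightarrow> real^'k) \<Rightarrow> real^2 \<Rightarrow> 2 \<Rightarrow> real" where
  "shift_coeff \<phi> C z a = (\<Sum>b\<in>UNIV. inverse_metric \<phi> z a b * (2 * (pd b \<phi> z \<bullet> C z)))"

text \<open>\<open>unit_normal\<close> before normalisation. Its pairing with \<open>(0, v)\<close>
  is just \<open>v $ s\<close>, and its length is the square root in the theorem.\<close>

definition normal_vec :: "(real^2 \<Rightarrow> real^'k::finite) \<Rightarrow> 'k \<Rightarrow> real^2 \<Rightarrow> (real^2) \<times> (real^'k)" where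
  "normal_vec \<phi> s y = (- grad (\<lambda>z. \<phi> z $ s) y, axis s 1)"

context
  fixes S :: "(real^2) set" and \<phi> :: "real^2 \<Rightarrow> real^'k::finite"
  assumes S: "open S" and smooth: "smooth_on S \<phi>"
begin

lemma differentiable_at_S: "z \<in> S \<Longrightarrow> \<phi> differentiable (at z)"
  using smooth by (rule smooth_on_imp_differentiable)

lemma smooth_on_graph_metric: "smooth_on S (\<lambda>z. graph_metric \<phi> z $ a $ b)"
  by (rule smooth_on_cong_open[OF S _ smooth_on_add[OF S smooth_on_const
          smooth_on_inner[OF S smooth_on_pd[OF smooth] smooth_on_pd[OF smooth]]]])
    (rule graph_metric_nth[OF differentiable_at_S, symmetric])

lemma smooth_on_det_graph_metric: "smooth_on S (\<lambda>z. det (graph_metric \<phi> z))"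
  unfolding det_2 by (intro smooth_on_diff smooth_on_mult smooth_on_graph_metric S)

lemma smooth_on_inverse_metric: "smooth_on S (\<lambda>z. inverse_metric \<phi> z a b)"
proof -
  have q: "smooth_on S (\<lambda>z. f z / det (graph_metric \<phi> z))" if "smooth_on S f" for f
    by (rule smooth_on_divide[OF S that smooth_on_det_graph_metric])
      (use det_graph_metric_pos[OF differentiable_at_S] in force)
  note e = inverse_metric_explicit[OF differentiable_at_S]
  have "smooth_on S (\<lambda>z. inverse_metric \<phi> z 1 1)"
    by (rule smooth_on_cong_open[OF S e(1)[symmetric] q]) (auto intro: smooth_on_graph_metric)
  moreover have "smooth_on S (\<lambda>z. inverse_metric \<phi> z 1 2)"
    by (rule smooth_on_cong_open[OF S e(2)[symmetric] q]) (auto intro: smooth_on_minus S smooth_on_graph_metric)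
  moreover have "smooth_on S (\<lambda>z. inverse_metric \<phi> z 2 1)"
    by (rule smooth_on_cong_open[OF S e(3)[symmetric] q]) (auto intro: smooth_on_minus S smooth_on_graph_metric)
  moreover have "smooth_on S (\<lambda>z. inverse_metric \<phi> z 2 2)"
    by (rule smooth_on_cong_open[OF S e(4)[symmetric] q]) (auto intro: smooth_on_graph_metric)
  ultimately show ?thesis
    using exhaust_2[of a] exhaust_2[of b] by auto
qed

lemma pd_graph_metric:
  assumes y: "y \<in> S"
  shows "pd e (\<lambda>z. graph_metric \<phi> z $ a $ b) y
    = pd e (pd a \<phi>) y \<bullet> pd b \<phi> y + pd e (pd b \<phi>) y \<bullet> pd a \<phi> y"
proof -
  note d = smooth_on_imp_differentiable[OF smooth_on_pd[OF smooth] y]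
  have "pd e (\<lambda>z. graph_metric \<phi> z $ a $ b) y
      = pd e (\<lambda>z. (if a = b then 1 else 0) + pd a \<phi> z \<bullet> pd b \<phi> z) y"
    by (rule pd_cong_open[OF S y graph_metric_nth[OF differentiable_at_S]])
  also have "\<dots> = pd e (\<lambda>z. pd a \<phi> z \<bullet> pd b \<phi> z) y"
    using pd_add[OF differentiable_const differentiable_inner[OF d d]] by simp
  finally show ?thesis
    by (simp add: pd_inner[OF d d] inner_commute)
qed

text \<open>Differentiate \<open>K G = 1\<close> and solve: \<open>K' = - K G' K\<close>.\<close>

lemma pd_inverse_metric:
  assumes y: "y \<in> S"
  shows "pd e (\<lambda>z. inverse_metric \<phi> z a b) y
    = - (\<Sum>c\<in>UNIV. inverse_metric \<phi> y b c * (\<Sum>f\<in>UNIV. inverse_metric \<phi> y a f * pd e (\<lambda>z. graph_metric \<phi> z $ f $ c) y))"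
proof -
  note dK = smooth_on_imp_differentiable[OF smooth_on_inverse_metric y]
    and dG = smooth_on_imp_differentiable[OF smooth_on_graph_metric y]
  have "(\<Sum>f\<in>UNIV. graph_metric \<phi> y $ c $ f * pd e (\<lambda>z. inverse_metric \<phi> z a f) y)
      = - (\<Sum>f\<in>UNIV. inverse_metric \<phi> y a f * pd e (\<lambda>z. graph_metric \<phi> z $ f $ c) y)" for c
  proof -
    have "0 = pd e (\<lambda>z. if a = c then 1 else 0 :: real) y" by simp
    also have "\<dots> = pd e (\<lambda>z. \<Sum>f\<in>UNIV. inverse_metric \<phi> z a f * graph_metric \<phi> z $ f $ c) y"
      by (rule pd_cong_open[OF S y inverse_metric_mult_left[OF differentiable_at_S, symmetric]])
    also have "\<dots> = (\<Sum>f\<in>UNIV. pd e (\<lambda>z. inverse_metric \<phi> z a f) y * graph_metric \<phi> y $ f $ c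
        + inverse_metric \<phi> y a f * pd e (\<lambda>z. graph_metric \<phi> z $ f $ c) y)"
      by (subst pd_sum) (auto intro!: differentiable_mult dK dG simp: pd_mult[OF dK dG])
    finally show ?thesis
      by (simp add: sum.distrib graph_metric_sym[of \<phi> y c] mult.commute eq_neg_iff_add_eq_0 add.commute)
  qed
  from solve_left_inverse[where K = "inverse_metric \<phi> y", OF inverse_metric_mult_left[OF differentiable_at_S[OF y]] this]
  show ?thesis by (simp add: sum_negf)
qed

text \<open>The derivative of the density \<open>sqrt (det g)\<close> cancels one of the two terms
  of the derivative of the inverse metric. What is left of first order contains the second
  derivatives of \<open>\<phi>\<close> only through their trace.\<close>

lemma laplace_beltrami_eq:
  assumes y: "y \<in> S" and f: "smooth_on S f"
  defines "K \<equiv> inverse_metric \<phi> y"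
  shows "laplace_beltrami \<phi> f y = (\<Sum>a\<in>UNIV. \<Sum>b\<in>UNIV. K a b * pd a (pd b f) y)
    - (\<Sum>b\<in>UNIV. (\<Sum>e\<in>UNIV. K b e * ((\<Sum>a\<in>UNIV. \<Sum>c\<in>UNIV. K a c *\<^sub>R pd a (pd c \<phi>) y) \<bullet> pd e \<phi> y)) * pd b f y)"
proof -
  define D where "D = (\<lambda>z. det (graph_metric \<phi> z))"
  \<comment> \<open>The Christoffel symbols of the first kind, symmetric in the first two
    arguments.\<close>
  define A where "A = (\<lambda>a c e. pd a (pd c \<phi>) y \<bullet> pd e \<phi> y)"
  note dK = smooth_on_imp_differentiable[OF smooth_on_inverse_metric y]
    and dG = smooth_on_imp_differentiable[OF smooth_on_graph_metric y]
    and df = smooth_on_imp_differentiable[OF smooth_on_pd[OF f] y]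
  have D: "D y > 0" and dD: "D differentiable (at y)"
    unfolding D_def by (rule det_graph_metric_pos[OF differentiable_at_S[OF y]], rule smooth_on_imp_differentiable[OF smooth_on_det_graph_metric y])
  have [simp]: "K 2 1 = K 1 2" and A21[simp]: "A 2 1 e = A 1 2 e" for e
    unfolding K_def A_def pd_commute[OF smooth S y, of 2 1] by (simp_all add: inverse_metric_sym[OF differentiable_at_S[OF y], of 2 1])
  have G': "pd a (\<lambda>z. graph_metric \<phi> z $ c $ e) y = A a c e + A a e c" for a c e
    by (simp add: pd_graph_metric[OF y] A_def)
  \<comment> \<open>Jacobi's formula: the logarithmic derivative of the determinant is the trace of
    the inverse metric times the derivative of the metric.\<close>
  have D': "pd a D y = D y * (\<Sum>c\<in>UNIV. \<Sum>e\<in>UNIV. K c e * (A a c e + A a e c))" for a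
  proof -
    note e = inverse_metric_explicit[OF differentiable_at_S[OF y], folded K_def]
    have "pd a D y = pd a (\<lambda>z. graph_metric \<phi> z $ 1 $ 1 * graph_metric \<phi> z $ 2 $ 2 - graph_metric \<phi> z $ 1 $ 2 * graph_metric \<phi> z $ 1 $ 2) y"
      unfolding D_def det_2 graph_metric_sym[of \<phi> _ 2 1] ..
    also have "\<dots> = (A a 1 1 + A a 1 1) * graph_metric \<phi> y $ 2 $ 2 + graph_metric \<phi> y $ 1 $ 1 * (A a 2 2 + A a 2 2)
        - 2 * graph_metric \<phi> y $ 1 $ 2 * (A a 1 2 + A a 2 1)"
      by (simp add: pd_diff[OF differentiable_mult[OF dG dG] differentiable_mult[OF dG dG]] pd_mult[OF dG dG] G')
    also have "\<dots> = D y * (\<Sum>c\<in>UNIV. \<Sum>e\<in>UNIV. K c e * (A a c e + A a e c))"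
      using D unfolding sum_2 e D_def by (simp add: field_simps)
    finally show ?thesis .
  qed
  have K': "pd a (\<lambda>z. inverse_metric \<phi> z b c) y = - (\<Sum>e\<in>UNIV. K c e * (\<Sum>f\<in>UNIV. K b f * (A a f e + A a e f)))" for a b c
    unfolding pd_inverse_metric[OF y] G' K_def ..
  have dS: "(\<lambda>z. \<Sum>b\<in>UNIV. inverse_metric \<phi> z a b * pd b f z) differentiable (at y)" for a
    by (intro differentiable_sum finite ballI differentiable_mult dK df)
  have ds: "(\<lambda>z. sqrt (D z)) differentiable (at y)"
    using has_derivative_real_sqrt[OF D has_derivative_frechet[OF dD]] by (rule differentiableI)
  define W where "W = (\<lambda>a. \<Sum>c\<in>UNIV. \<Sum>e\<in>UNIV. K c e * A a c e)"
  have W2: "(\<Sum>c\<in>UNIV. \<Sum>e\<in>UNIV. K c e * (A a c e + A a e c)) = 2 * W a" for a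
    by (simp add: W_def sum_2 algebra_simps)
  have W: "pd a (\<lambda>z. sqrt (D z) * (\<Sum>b\<in>UNIV. inverse_metric \<phi> z a b * pd b f z)) y
    = sqrt (D y) * (\<Sum>b\<in>UNIV. W a * K a b * pd b f y
        + pd a (\<lambda>z. inverse_metric \<phi> z a b) y * pd b f y + K a b * pd a (pd b f) y)" for a
  proof -
    have 1: "pd a (\<lambda>z. \<Sum>b\<in>UNIV. inverse_metric \<phi> z a b * pd b f z) y
      = (\<Sum>b\<in>UNIV. pd a (\<lambda>z. inverse_metric \<phi> z a b) y * pd b f y + K a b * pd a (pd b f) y)"
      by (subst pd_sum) (auto intro!: differentiable_mult dK df simp: pd_mult[OF dK df] K_def)
    have 2: "pd a (\<lambda>z. sqrt (D z)) y = sqrt (D y) * W a"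
      using D unfolding pd_sqrt[OF dD D] D' W2 by (simp add: field_simps)
    show ?thesis
      unfolding pd_mult[OF ds dS] 1 2 K_def[symmetric] by (simp add: sum_2 algebra_simps)
  qed
  have "laplace_beltrami \<phi> f y
    = (\<Sum>a\<in>UNIV. pd a (\<lambda>z. sqrt (D z) * (\<Sum>b\<in>UNIV. inverse_metric \<phi> z a b * pd b f z)) y) / sqrt (D y)"
    by (simp only: laplace_beltrami_def D_def inverse_metric_def)
  also have "\<dots> = (\<Sum>a\<in>UNIV. \<Sum>b\<in>UNIV. W a * K a b * pd b f y
        + pd a (\<lambda>z. inverse_metric \<phi> z a b) y * pd b f y + K a b * pd a (pd b f) y)"
    using D unfolding W sum_distrib_left[symmetric] by simp
  \<comment> \<open>By \<open>A a e f = A e a f\<close>, the second part of the derivative of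
    \<open>K\<close> sums to \<open>- W e * K b e\<close>, which cancels the density term.\<close>
  also have "\<dots> = (\<Sum>a\<in>UNIV. \<Sum>b\<in>UNIV. K a b * pd a (pd b f) y)
    - (\<Sum>b\<in>UNIV. (\<Sum>e\<in>UNIV. K b e * (\<Sum>a\<in>UNIV. \<Sum>c\<in>UNIV. K a c * A a c e)) * pd b f y)"
    unfolding K' W_def by (simp add: sum_2 algebra_simps)
  finally show ?thesis
    by (simp add: A_def inner_sum_left)
qed


lemma laplace_beltrami_linear:
  assumes y: "y \<in> S" and I: "finite I" and f: "\<And>i. i \<in> I \<Longrightarrow> smooth_on S (f i)"
  shows "laplace_beltrami \<phi> (\<lambda>z. \<Sum>i\<in>I. k i * f i z) y = (\<Sum>i\<in>I. k i * laplace_beltrami \<phi> (f i) y)"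
proof -
  let ?F = "\<lambda>z. \<Sum>i\<in>I. k i * f i z"
  have sF: "smooth_on S ?F"
    by (intro smooth_on_sum smooth_on_mult S smooth_on_const f)
  have p: "pd b (\<lambda>z. \<Sum>i\<in>I. k i * g i z) z = (\<Sum>i\<in>I. k i * pd b (g i) z)"
    if "z \<in> S" "\<And>i. i \<in> I \<Longrightarrow> smooth_on S (g i)" for b z g
  proof -
    have d: "g i differentiable (at z)" if "i \<in> I" for i
      using smooth_on_imp_differentiable \<open>z \<in> S\<close> \<open>\<And>i. i \<in> I \<Longrightarrow> smooth_on S (g i)\<close> that by blast
    have "pd b (\<lambda>z. \<Sum>i\<in>I. k i * g i z) z = (\<Sum>i\<in>I. pd b (\<lambda>z. k i * g i z) z)"
      by (rule pd_sum) (intro differentiable_mult differentiable_const d)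
    also have "\<dots> = (\<Sum>i\<in>I. k i * pd b (g i) z)"
      by (intro sum.cong refl pd_bounded_linear[OF bounded_linear_mult_right] d)
    finally show ?thesis .
  qed
  have pp: "pd a (pd b ?F) y = (\<Sum>i\<in>I. k i * pd a (pd b (f i)) y)" for a b
  proof -
    have "pd a (pd b ?F) y = pd a (\<lambda>z. \<Sum>i\<in>I. k i * pd b (f i) z) y"
      by (rule pd_cong_open[OF S y p]) (use f in auto)
    also have "\<dots> = (\<Sum>i\<in>I. k i * pd a (pd b (f i)) y)"
      by (rule p[OF y smooth_on_pd[OF f]])
    finally show ?thesis .
  qed
  define K where "K = inverse_metric \<phi> y"
  define L where "L = (\<lambda>b. \<Sum>e\<in>UNIV. K b e * ((\<Sum>a\<in>UNIV. \<Sum>c\<in>UNIV. K a c *\<^sub>R pd a (pd c \<phi>) y) \<bullet> pd e \<phi> y))"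
  have lb: "laplace_beltrami \<phi> g y = (\<Sum>a\<in>UNIV. \<Sum>b\<in>UNIV. K a b * pd a (pd b g) y) - (\<Sum>b\<in>UNIV. L b * pd b g y)"
    if "smooth_on S g" for g
    unfolding L_def K_def by (rule laplace_beltrami_eq[OF y that])
  show ?thesis
    by (simp add: lb[OF sF] lb[OF f] pp p[OF y f] sum_2 sum_distrib_left sum.distrib sum_subtractf algebra_simps)
qed

text \<open>As \<open>w\<close> does not move with the base point, pairing with the normal at
  \<open>y\<close> reduces the vector Laplacian to that of one scalar function.\<close>

lemma laplace_beltrami_vec_inner:
  assumes y: "y \<in> S" and F: "smooth_on S F"
  shows "laplace_beltrami_vec \<phi> F y \<bullet> w = laplace_beltrami \<phi> (\<lambda>z. F z \<bullet> w) y"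
proof -
  have "laplace_beltrami_vec \<phi> F y \<bullet> w = (\<Sum>b\<in>Basis. (b \<bullet> w) * laplace_beltrami \<phi> (\<lambda>z. F z \<bullet> b) y)"
    by (simp only: laplace_beltrami_vec_def inner_sum_left inner_scaleR_left mult.commute)
  also have "\<dots> = laplace_beltrami \<phi> (\<lambda>z. \<Sum>b\<in>Basis. (b \<bullet> w) * (F z \<bullet> b)) y"
    by (rule laplace_beltrami_linear[OF y finite_Basis smooth_on_inner[OF S F smooth_on_const], symmetric])
  also have "(\<lambda>z. \<Sum>b\<in>Basis. (b \<bullet> w) * (F z \<bullet> b)) = (\<lambda>z. F z \<bullet> w)"
  proof
    fix z show "(\<Sum>b\<in>Basis. (b \<bullet> w) * (F z \<bullet> b)) = F z \<bullet> w"
      using euclidean_inner[of "F z" w] by (simp only: inner_commute[of w] mult.commute)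
  qed
  finally show ?thesis .
qed

lemma smooth_on_coord_tangent: "smooth_on S (\<lambda>z. coord_tangent \<phi> z a)"
proof -
  have "bounded_linear (\<lambda>x. (0 :: real^2, x :: real^'k))"
    by (intro bounded_linear_Pair bounded_linear_zero bounded_linear_ident)
  from smooth_on_add[OF S smooth_on_const[of S "(axis a 1, 0)"] smooth_on_bounded_linear[OF this S smooth_on_pd[OF smooth]]]
  show ?thesis by (simp add: coord_tangent_def)
qed

lemma pd_pd_mult:
  fixes f g :: "real^2 \<Rightarrow> real"
  assumes y: "y \<in> S" and f: "smooth_on S f" and g: "smooth_on S g"
  shows "pd a (pd b (\<lambda>z. f z * g z)) y
    = pd a (pd b f) y * g y + pd b f y * pd a g y + pd a f y * pd b g y + f y * pd a (pd b g) y"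
proof -
  note d = smooth_on_imp_differentiable[OF _ y]
  have "pd a (pd b (\<lambda>z. f z * g z)) y = pd a (\<lambda>z. pd b f z * g z + f z * pd b g z) y"
    by (rule pd_cong_open[OF S y]) (intro pd_mult smooth_on_imp_differentiable[OF f] smooth_on_imp_differentiable[OF g])
  also have "\<dots> = pd a (\<lambda>z. pd b f z * g z) y + pd a (\<lambda>z. f z * pd b g z) y"
    by (intro pd_add d smooth_on_mult S smooth_on_pd f g)
  finally show ?thesis
    using pd_mult[OF d[OF smooth_on_pd[OF f]] d[OF g]] pd_mult[OF d[OF f] d[OF smooth_on_pd[OF g]]] by simp
qed

lemma pd_pd_diff:
  assumes y: "y \<in> S" and f: "smooth_on S f" and g: "smooth_on S g"
  shows "pd a (pd b (\<lambda>z. f z - g z)) y = pd a (pd b f) y - pd a (pd b g) y"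
  using pd_cong_open[OF S y pd_diff[OF smooth_on_imp_differentiable[OF f] smooth_on_imp_differentiable[OF g]]]
    pd_diff[OF smooth_on_imp_differentiable[OF smooth_on_pd[OF f] y] smooth_on_imp_differentiable[OF smooth_on_pd[OF g] y]]
  by simp

lemma pd_pd_add:
  assumes y: "y \<in> S" and f: "smooth_on S f" and g: "smooth_on S g"
  shows "pd a (pd b (\<lambda>z. f z + g z)) y = pd a (pd b f) y + pd a (pd b g) y"
  using pd_cong_open[OF S y pd_add[OF smooth_on_imp_differentiable[OF f] smooth_on_imp_differentiable[OF g]]]
    pd_add[OF smooth_on_imp_differentiable[OF smooth_on_pd[OF f] y] smooth_on_imp_differentiable[OF smooth_on_pd[OF g] y]]
  by simp

lemma pd_pd_vec_nth:
  fixes f :: "real^2 \<Rightarrow> real^'k"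
  assumes y: "y \<in> S" and f: "smooth_on S f"
  shows "pd a (pd b (\<lambda>z. f z $ s)) y = pd a (pd b f) y $ s"
  using pd_cong_open[OF S y pd_vec_nth[OF smooth_on_imp_differentiable[OF f]]]
    pd_vec_nth[OF smooth_on_imp_differentiable[OF smooth_on_pd[OF f] y]]
  by simp

section \<open>Mean curvature under the trace equation, with \<open>C\<close> in the role of
  \<open>c 2\<close>\<close>

context
  fixes C :: "real^2 \<Rightarrow> real^'k"
  assumes C: "smooth_on S C"
    and tr: "\<And>z. z \<in> S \<Longrightarrow> (\<Sum>a\<in>UNIV. \<Sum>b\<in>UNIV. inverse_metric \<phi> z a b *\<^sub>R pd a (pd b \<phi>) z) = 4 *\<^sub>R C z"
begin

lemma mean_curvature_eq_normal_proj:
  assumes z: "z \<in> S"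
  shows "mean_curvature \<phi> z = 2 *\<^sub>R normal_proj \<phi> z (0, C z)"
proof -
  note lin = linear_normal_proj[OF differentiable_at_S[OF z]]
  have "mean_curvature \<phi> z = (1/2) *\<^sub>R normal_proj \<phi> z (\<Sum>a\<in>UNIV. \<Sum>b\<in>UNIV. inverse_metric \<phi> z a b *\<^sub>R (0, pd a (pd b \<phi>) z))"
    unfolding mean_curvature_eq[OF smooth S z] coord_second_ff_def by (simp only: linear_sum[OF lin] linear_scale[OF lin])
  also have "(\<Sum>a\<in>UNIV. \<Sum>b\<in>UNIV. inverse_metric \<phi> z a b *\<^sub>R (0 :: real^2, pd a (pd b \<phi>) z)) = 4 *\<^sub>R (0, C z)"
    using tr[OF z] by (simp add: sum_2)
  finally show ?thesis by (simp only: linear_scale[OF lin]) simp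
qed

lemma mean_curvature_graph:
  assumes z: "z \<in> S"
  shows "mean_curvature \<phi> z = 2 *\<^sub>R (0, C z) - (\<Sum>a\<in>UNIV. shift_coeff \<phi> C z a *\<^sub>R coord_tangent \<phi> z a)"
proof -
  have "(0, C z) \<bullet> coord_tangent \<phi> z b = pd b \<phi> z \<bullet> C z" for b
    by (simp add: coord_tangent_def inner_commute)
  then show ?thesis
    unfolding mean_curvature_eq_normal_proj[OF z] normal_proj_eq[OF differentiable_at_S[OF z]] shift_coeff_def
    by (simp add: sum_2 algebra_simps)
qed

lemma smooth_on_shift_coeff: "smooth_on S (\<lambda>z. shift_coeff \<phi> C z a)"
  unfolding shift_coeff_def
  by (intro smooth_on_sum smooth_on_mult smooth_on_inner S smooth_on_inverse_metric smooth_on_const smooth_on_pd smooth C)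

lemma smooth_on_mean_curvature: "smooth_on S (mean_curvature \<phi>)"
proof -
  have "bounded_linear (\<lambda>x. 2 *\<^sub>R (0 :: real^2, x :: real^'k))"
    by (intro bounded_linear_scaleR_right[THEN bounded_linear_compose] bounded_linear_Pair bounded_linear_zero bounded_linear_ident)
  then have 1: "smooth_on S (\<lambda>z. 2 *\<^sub>R (0 :: real^2, C z))"
    by (rule smooth_on_bounded_linear[OF _ S C])
  have 2: "smooth_on S (\<lambda>z. \<Sum>a\<in>UNIV. shift_coeff \<phi> C z a *\<^sub>R coord_tangent \<phi> z a)"
    by (intro smooth_on_sum S smooth_on_bounded_bilinear[OF bounded_bilinear_scaleR S] smooth_on_shift_coeff smooth_on_coord_tangent)
  show ?thesis
    by (rule smooth_on_cong_open[OF S mean_curvature_graph[symmetric] smooth_on_diff[OF S 1 2]])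
qed

text \<open>Since \<open>K' = - K G' K\<close> and \<open>K p\<close> is \<open>shift_coeff\<close>
  again, the derivative keeps a single inverse metric in front.\<close>

lemma pd_shift_coeff:
  assumes y: "y \<in> S"
  shows "pd b (\<lambda>z. shift_coeff \<phi> C z c) y = (\<Sum>d\<in>UNIV. inverse_metric \<phi> y c d *
     (2 * (pd b (pd d \<phi>) y \<bullet> C y) + 2 * (pd d \<phi> y \<bullet> pd b C y)
      - (\<Sum>f\<in>UNIV. pd b (\<lambda>z. graph_metric \<phi> z $ d $ f) y * shift_coeff \<phi> C y f)))"
proof -
  note d = smooth_on_imp_differentiable[OF _ y]
  have p: "pd b (\<lambda>z. 2 * (pd e \<phi> z \<bullet> C z)) y = 2 * (pd b (pd e \<phi>) y \<bullet> C y) + 2 * (pd e \<phi> y \<bullet> pd b C y)" for e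
    using pd_bounded_linear[OF bounded_linear_mult_right d[OF smooth_on_inner[OF S smooth_on_pd[OF smooth] C]], of b 2 e]
      pd_inner[OF d[OF smooth_on_pd[OF smooth]] d[OF C]] by simp
  have sp: "smooth_on S (\<lambda>z. 2 * (pd e \<phi> z \<bullet> C z))" for e
    by (intro smooth_on_mult smooth_on_inner S smooth_on_const smooth_on_pd smooth C)
  have "pd b (\<lambda>z. shift_coeff \<phi> C z c) y = (\<Sum>e\<in>UNIV. pd b (\<lambda>z. inverse_metric \<phi> z c e * (2 * (pd e \<phi> z \<bullet> C z))) y)"
    unfolding shift_coeff_def by (intro pd_sum d smooth_on_mult S smooth_on_inverse_metric sp)
  also have "\<dots> = (\<Sum>e\<in>UNIV. pd b (\<lambda>z. inverse_metric \<phi> z c e) y * (2 * (pd e \<phi> y \<bullet> C y))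
      + inverse_metric \<phi> y c e * (2 * (pd b (pd e \<phi>) y \<bullet> C y) + 2 * (pd e \<phi> y \<bullet> pd b C y)))"
    unfolding pd_mult[OF d[OF smooth_on_inverse_metric] d[OF sp]] p ..
  finally show ?thesis
    unfolding pd_inverse_metric[OF y] shift_coeff_def
    by (simp add: sum_2 algebra_simps inverse_metric_sym[OF differentiable_at_S[OF y], of 2 1])
qed

text \<open>The tangent vector moves with \<open>z\<close> while the normal stays at
  \<open>y\<close>; their pairing vanishes at \<open>z = y\<close> but its derivatives do
  not.\<close>

lemma inner_normal_vec:
  assumes y: "y \<in> S"
  shows "(0, v) \<bullet> normal_vec \<phi> s y = v $ s"
    "coord_tangent \<phi> z a \<bullet> normal_vec \<phi> s y = pd a \<phi> z $ s - pd a \<phi> y $ s"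
proof -
  show "(0, v) \<bullet> normal_vec \<phi> s y = v $ s"
    by (simp add: normal_vec_def inner_axis)
  have "grad (\<lambda>z. \<phi> z $ s) y $ a = pd a \<phi> y $ s"
    by (simp add: grad_def pd_vec_nth[OF differentiable_at_S[OF y]])
  then show "coord_tangent \<phi> z a \<bullet> normal_vec \<phi> s y = pd a \<phi> z $ s - pd a \<phi> y $ s"
    by (simp add: normal_vec_def coord_tangent_def inner_axis inner_commute[of "axis a 1"])
qed

lemma normal_proj_inner_normal_vec:
  assumes y: "y \<in> S"
  shows "normal_proj \<phi> y v \<bullet> normal_vec \<phi> s y = v \<bullet> normal_vec \<phi> s y"
  by (simp add: normal_proj_eq[OF differentiable_at_S[OF y]] inner_diff_left inner_sum_left inner_normal_vec[OF y])

text \<open>Near \<open>y\<close> the paired function is \<open>2 C_s\<close> minus the sum of the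
  products of \<open>shift_coeff\<close> and \<open>q c\<close>. As \<open>q c\<close> vanishes at
  \<open>y\<close>, first derivatives fall on \<open>q c\<close> alone, and second derivatives never
  fall twice on \<open>shift_coeff\<close>.\<close>

lemma laplace_beltrami_mean_curvature_inner:
  assumes y: "y \<in> S"
  defines "K \<equiv> inverse_metric \<phi> y" and "P \<equiv> shift_coeff \<phi> C y"
  shows "laplace_beltrami_vec \<phi> (mean_curvature \<phi>) y \<bullet> normal_vec \<phi> s y
    = (\<Sum>a\<in>UNIV. \<Sum>b\<in>UNIV. K a b * (2 * pd a (pd b C) y $ s
        - (\<Sum>c\<in>UNIV. pd b (\<lambda>z. shift_coeff \<phi> C z c) y * pd a (pd c \<phi>) y $ s
            + pd a (\<lambda>z. shift_coeff \<phi> C z c) y * pd b (pd c \<phi>) y $ s + P c * pd a (pd b (pd c \<phi>)) y $ s)))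
      - 2 * (\<Sum>b\<in>UNIV. P b * (2 * pd b C y $ s - (\<Sum>c\<in>UNIV. P c * pd b (pd c \<phi>) y $ s)))"
proof -
  let ?H = "\<lambda>z. mean_curvature \<phi> z \<bullet> normal_vec \<phi> s y"
  define q where "q = (\<lambda>c z. pd c \<phi> z $ s - pd c \<phi> y $ s)"
  define f where "f = (\<lambda>z. 2 * C z $ s - (shift_coeff \<phi> C z 1 * q 1 z + shift_coeff \<phi> C z 2 * q 2 z))"
  note d = smooth_on_imp_differentiable[OF _ y]
  have q0: "q c y = 0" for c by (simp add: q_def)
  have sq: "smooth_on S (q c)" for c
    unfolding q_def by (intro smooth_on_diff S smooth_on_const smooth_on_vec_nth smooth_on_pd smooth)
  have spq: "smooth_on S (\<lambda>z. shift_coeff \<phi> C z c * q c z)" for c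
    by (rule smooth_on_mult[OF S smooth_on_shift_coeff sq])
  have sC: "smooth_on S (\<lambda>z. C z $ s)" and s2C: "smooth_on S (\<lambda>z. 2 * C z $ s)"
    by (intro smooth_on_mult S smooth_on_const smooth_on_vec_nth C)+
  have sf: "smooth_on S f"
    unfolding f_def by (rule smooth_on_diff[OF S s2C smooth_on_add[OF S spq spq]])
  have Hf: "?H z = f z" if "z \<in> S" for z
    by (simp add: mean_curvature_graph[OF that] f_def q_def sum_2 inner_diff_left inner_add_left inner_normal_vec[OF y]
        inner_normal_vec(1)[OF y, of "2 *\<^sub>R C z", simplified])
  have pq: "pd b (q c) z = pd b (pd c \<phi>) z $ s" if "z \<in> S" for b c z
    unfolding q_def
    by (subst pd_diff) (auto simp: pd_vec_nth[OF smooth_on_imp_differentiable[OF smooth_on_pd[OF smooth] that]]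
        intro!: smooth_on_imp_differentiable[OF smooth_on_vec_nth[OF S smooth_on_pd[OF smooth]] that])
  have ppq: "pd a (pd b (q c)) y = pd a (pd b (pd c \<phi>)) y $ s" for a b c
    using pd_cong_open[OF S y pq] pd_vec_nth[OF d[OF smooth_on_pd[OF smooth_on_pd[OF smooth]]]] by simp
  have p2C: "pd b (\<lambda>z. 2 * C z $ s) y = 2 * pd b C y $ s" for b
    using pd_bounded_linear[OF bounded_linear_mult_right d[OF sC]] pd_vec_nth[OF d[OF C]] by simp
  have pp2C: "pd a (pd b (\<lambda>z. 2 * C z $ s)) y = 2 * pd a (pd b C) y $ s" for a b
    using pd_pd_mult[OF y smooth_on_const sC, of a b 2] pd_pd_vec_nth[OF y C] by (simp add: pd_const[abs_def])
  have pf: "pd b f y = 2 * pd b C y $ s - (\<Sum>c\<in>UNIV. P c * pd b (pd c \<phi>) y $ s)" for b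
    unfolding f_def pd_diff[OF d[OF s2C] d[OF smooth_on_add[OF S spq spq]]] pd_add[OF d[OF spq] d[OF spq]]
      pd_mult[OF d[OF smooth_on_shift_coeff] d[OF sq]] p2C
    by (simp add: pq[OF y] q0 sum_2 P_def)
  have ppf: "pd a (pd b f) y = 2 * pd a (pd b C) y $ s
        - (\<Sum>c\<in>UNIV. pd b (\<lambda>z. shift_coeff \<phi> C z c) y * pd a (pd c \<phi>) y $ s
            + pd a (\<lambda>z. shift_coeff \<phi> C z c) y * pd b (pd c \<phi>) y $ s + P c * pd a (pd b (pd c \<phi>)) y $ s)" for a b
    unfolding f_def pd_pd_diff[OF y s2C smooth_on_add[OF S spq spq]] pd_pd_add[OF y spq spq]
      pd_pd_mult[OF y smooth_on_shift_coeff sq] pp2C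
    by (simp add: pq[OF y] ppq q0 sum_2 P_def)
  have pH: "pd b ?H z = pd b f z" if "z \<in> S" for b z
    by (rule pd_cong_open[OF S that Hf])
  have ppH: "pd a (pd b ?H) y = pd a (pd b f) y" for a b
    by (rule pd_cong_open[OF S y pH])
  \<comment> \<open>The trace is \<open>4 C\<close>, twice the factor 2 built into
    \<open>shift_coeff\<close>; hence the first-order coefficient \<open>2 P\<close> of the
    Laplacian.\<close>
  have shift: "(\<Sum>e\<in>UNIV. K b e * ((\<Sum>a\<in>UNIV. \<Sum>c\<in>UNIV. K a c *\<^sub>R pd a (pd c \<phi>) y) \<bullet> pd e \<phi> y)) = 2 * P b" for b
    unfolding K_def tr[OF y] P_def shift_coeff_def by (simp add: sum_2 inner_commute)
  have sH: "smooth_on S ?H"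
    by (rule smooth_on_inner[OF S smooth_on_mean_curvature smooth_on_const])
  show ?thesis
    unfolding laplace_beltrami_vec_inner[OF y smooth_on_mean_curvature]
      laplace_beltrami_eq[OF y sH, folded K_def, unfolded shift] ppH pH[OF y] pf ppf
    by (simp add: sum_distrib_left mult.assoc)
qed

lemma pd_pd_pd_rotate:
  assumes y: "y \<in> S"
  shows "pd a (pd b (pd c \<phi>)) y = pd c (pd a (pd b \<phi>)) y"
proof -
  have "pd a (pd b (pd c \<phi>)) y = pd a (pd c (pd b \<phi>)) y"
    by (rule pd_cong_open[OF S y pd_commute[OF smooth S]])
  also have "\<dots> = pd c (pd a (pd b \<phi>)) y"
    by (rule pd_commute[OF smooth_on_pd[OF smooth] S y])
  finally show ?thesis .
qed

text \<open>Trades contracted third derivatives of \<open>\<phi>\<close> for first derivatives of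
  \<open>C\<close> and of the inverse metric.\<close>

lemma pd_trace:
  assumes y: "y \<in> S"
  shows "(\<Sum>a\<in>UNIV. \<Sum>b\<in>UNIV. pd c (\<lambda>z. inverse_metric \<phi> z a b) y * pd a (pd b \<phi>) y $ s
      + inverse_metric \<phi> y a b * pd c (pd a (pd b \<phi>)) y $ s) = 4 * pd c C y $ s"
proof -
  note d = smooth_on_imp_differentiable[OF _ y]
  have sS: "smooth_on S (\<lambda>z. pd a (pd b \<phi>) z $ s)" for a b
    by (intro smooth_on_vec_nth S smooth_on_pd smooth)
  have pS: "pd c (\<lambda>z. pd a (pd b \<phi>) z $ s) y = pd c (pd a (pd b \<phi>)) y $ s" for a b
    by (intro pd_vec_nth d smooth_on_pd smooth)
  have dS: "(\<lambda>z. inverse_metric \<phi> z a b * pd a (pd b \<phi>) z $ s) differentiable (at y)" for a b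
    by (intro d smooth_on_mult S smooth_on_inverse_metric sS)
  have "4 * pd c C y $ s = pd c (\<lambda>z. 4 * C z $ s) y"
    using pd_bounded_linear[OF bounded_linear_mult_right d[OF smooth_on_vec_nth[OF S C]]] pd_vec_nth[OF d[OF C]] by simp
  also have "\<dots> = pd c (\<lambda>z. \<Sum>a\<in>UNIV. \<Sum>b\<in>UNIV. inverse_metric \<phi> z a b * pd a (pd b \<phi>) z $ s) y"
    by (rule pd_cong_open[OF S y]) (drule arg_cong[OF tr, of _ "\<lambda>v. v $ s"], simp add: sum_2)
  also have "\<dots> = (\<Sum>a\<in>UNIV. \<Sum>b\<in>UNIV. pd c (\<lambda>z. inverse_metric \<phi> z a b * pd a (pd b \<phi>) z $ s) y)"
    by (simp add: pd_sum differentiable_sum dS)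
  finally show ?thesis
    by (simp add: pd_mult[OF d[OF smooth_on_inverse_metric] d[OF sS]] pS)
qed

text \<open>The bracket on the right is what accompanies \<open>4 d41\<close> in the order-2
  equation of \<open>formal_mss_log_ansatz_eq_0D\<close>. Both sides are expressed through
  \<open>P\<close>, \<open>T\<close>, \<open>R\<close> and the scalars \<open>A\<close>,
  \<open>m\<close>, \<open>n\<close>.\<close>

lemma curvature_expression_eq:
  assumes y: "y \<in> S"
  defines "K \<equiv> inverse_metric \<phi> y" and "H \<equiv> mean_curvature \<phi> y"
  defines "p \<equiv> \<lambda>a. 2 * (pd a \<phi> y \<bullet> C y)"
    and "h \<equiv> \<lambda>a b. pd a \<phi> y \<bullet> pd b C y + pd a C y \<bullet> pd b \<phi> y"
  shows "(normal_proj \<phi> y (laplace_beltrami_vec \<phi> (mean_curvature \<phi>) y)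
      - (2 * (norm H)\<^sup>2) *\<^sub>R H + 2 *\<^sub>R Q_II \<phi> y H) \<bullet> normal_vec \<phi> s y
    = 2 * ((\<Sum>a\<in>UNIV. \<Sum>b\<in>UNIV. K a b * pd a (pd b C) y $ s)
      + (\<Sum>a\<in>UNIV. \<Sum>b\<in>UNIV. (\<Sum>e\<in>UNIV. K a e * (p e * (\<Sum>f\<in>UNIV. p f * K f b) - (\<Sum>f\<in>UNIV. h e f * K f b)))
          * pd a (pd b \<phi>) y $ s)
      - 2 * (\<Sum>a\<in>UNIV. ((\<Sum>b\<in>UNIV. K a b * p b) + (\<Sum>b\<in>UNIV. p b * K b a)) * pd a C y $ s)
      + 2 * ((\<Sum>a\<in>UNIV. p a * (\<Sum>b\<in>UNIV. K a b * p b)) - 4 * (C y \<bullet> C y)) * C y $ s)"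
proof -
  define P where "P = shift_coeff \<phi> C y"
  define T where "T = (\<lambda>a b. pd a (pd b \<phi>) y $ s)"
  have Tf: "pd a (pd b \<phi>) y $ s = T a b" for a b
    by (simp add: T_def)
  define A where "A = (\<lambda>a b c. pd a (pd b \<phi>) y \<bullet> pd c \<phi> y)"
  define m where "m = (\<lambda>a b. pd a (pd b \<phi>) y \<bullet> C y)"
  define n where "n = (\<lambda>a b. pd a \<phi> y \<bullet> pd b C y)"
  define Q where "Q = (\<lambda>b d. 2 * m b d + 2 * n d b - (\<Sum>f\<in>UNIV. (A b d f + A b f d) * P f))"
  \<comment> \<open>\<open>T\<close> with both indices raised: all contractions with second derivatives are linear in it.\<close>
  define R where "R = (\<lambda>b d. \<Sum>a\<in>UNIV. \<Sum>c\<in>UNIV. K a b * K c d * T a c)"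
  have K21: "K 2 1 = K 1 2"
    unfolding K_def by (rule inverse_metric_sym[OF differentiable_at_S[OF y]])
  have sym: "T 2 1 = T 1 2" "A 2 1 c = A 1 2 c" "m 2 1 = m 1 2" for c
    unfolding T_def A_def m_def pd_commute[OF smooth S y, of 2 1] by simp_all
  have R21: "R 2 1 = R 1 2"
    by (simp add: R_def sum_2 K21 sym algebra_simps)
  have P: "P a = (\<Sum>b\<in>UNIV. K a b * p b)" "P a = (\<Sum>b\<in>UNIV. p b * K b a)" for a
    using exhaust_2[of a] by (auto simp: P_def shift_coeff_def K_def[symmetric] p_def sum_2 K21 mult.commute)
  have G': "pd c (\<lambda>z. graph_metric \<phi> z $ a $ b) y = A c a b + A c b a" for a b c
    by (simp add: pd_graph_metric[OF y] A_def)
  have P': "pd b (\<lambda>z. shift_coeff \<phi> C z c) y = (\<Sum>d\<in>UNIV. K c d * Q b d)" for b c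
    unfolding pd_shift_coeff[OF y] G' Q_def m_def n_def K_def P_def ..
  have K': "pd c (\<lambda>z. inverse_metric \<phi> z a b) y = - (\<Sum>e\<in>UNIV. K b e * (\<Sum>f\<in>UNIV. K a f * (A c f e + A c e f)))" for a b c
    unfolding pd_inverse_metric[OF y] G' K_def ..
  \<comment> \<open>The two cross terms of the second derivative of a product agree after exchanging
    \<open>a\<close> and \<open>b\<close>, hence the 2.\<close>
  have QR: "(\<Sum>a\<in>UNIV. \<Sum>b\<in>UNIV. K a b * (\<Sum>c\<in>UNIV. (\<Sum>d\<in>UNIV. K c d * Q b d) * T a c + (\<Sum>d\<in>UNIV. K c d * Q a d) * T b c))
      = 2 * (\<Sum>b\<in>UNIV. \<Sum>d\<in>UNIV. Q b d * R b d)"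
    unfolding R_def by (simp add: sum_2 K21 sym algebra_simps)
  have third: "(\<Sum>a\<in>UNIV. \<Sum>b\<in>UNIV. K a b * pd a (pd b (pd c \<phi>)) y $ s)
      = 4 * pd c C y $ s + (\<Sum>e\<in>UNIV. \<Sum>f\<in>UNIV. (A c e f + A c f e) * R e f)" for c
  proof -
    have "(\<Sum>a\<in>UNIV. \<Sum>b\<in>UNIV. pd c (\<lambda>z. inverse_metric \<phi> z a b) y * T a b)
        = - (\<Sum>e\<in>UNIV. \<Sum>f\<in>UNIV. (A c e f + A c f e) * R e f)"
      unfolding K' R_def by (simp add: sum_2 K21 sym algebra_simps)
    then show ?thesis
      using pd_trace[OF y, of c s] unfolding pd_pd_pd_rotate[OF y, of _ _ c]
      by (simp add: sum.distrib T_def K_def)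
  qed
  have lap: "laplace_beltrami_vec \<phi> (mean_curvature \<phi>) y \<bullet> normal_vec \<phi> s y
    = 2 * (\<Sum>a\<in>UNIV. \<Sum>b\<in>UNIV. K a b * pd a (pd b C) y $ s) - 2 * (\<Sum>b\<in>UNIV. \<Sum>d\<in>UNIV. Q b d * R b d)
      - (\<Sum>c\<in>UNIV. P c * (4 * pd c C y $ s + (\<Sum>e\<in>UNIV. \<Sum>f\<in>UNIV. (A c e f + A c f e) * R e f)))
      - 4 * (\<Sum>b\<in>UNIV. P b * pd b C y $ s) + 2 * (\<Sum>b\<in>UNIV. \<Sum>c\<in>UNIV. P b * P c * T b c)"
    unfolding laplace_beltrami_mean_curvature_inner[OF y, folded K_def P_def] P' third[symmetric] QR[symmetric] Tf
    by (simp add: sum_2 algebra_simps)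
  have HX: "H \<bullet> coord_tangent \<phi> y a = 0" for a
    by (simp add: H_def mean_curvature_eq_normal_proj[OF y] normal_proj_orthogonal[OF differentiable_at_S[OF y]])
  have H: "H = 2 *\<^sub>R (0, C y) - (\<Sum>a\<in>UNIV. P a *\<^sub>R coord_tangent \<phi> y a)"
    unfolding H_def P_def by (rule mean_curvature_graph[OF y])
  have HN: "H \<bullet> normal_vec \<phi> s y = 2 * C y $ s"
    unfolding H_def by (simp add: mean_curvature_eq_normal_proj[OF y] normal_proj_inner_normal_vec[OF y] inner_normal_vec[OF y])
  have H0: "H \<bullet> (0, v) = 2 * (C y \<bullet> v) - (\<Sum>a\<in>UNIV. P a * (pd a \<phi> y \<bullet> v))" for v
    by (simp add: H inner_diff_left inner_sum_left coord_tangent_def)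
  \<comment> \<open>\<open>H\<close> is normal, so in \<open>H . H\<close> the tangential part of
    one factor drops out, leaving \<open>2 H . (0, C)\<close>.\<close>
  have HH: "(norm H)\<^sup>2 = 4 * (C y \<bullet> C y) - (\<Sum>a\<in>UNIV. P a * p a)"
  proof -
    have "(norm H)\<^sup>2 = H \<bullet> (2 *\<^sub>R (0, C y) - (\<Sum>a\<in>UNIV. P a *\<^sub>R coord_tangent \<phi> y a))"
      using arg_cong[OF H, of "\<lambda>v. H \<bullet> v"] by (simp only: power2_norm_eq_inner)
    also have "\<dots> = 2 * (H \<bullet> (0, C y))"
      by (simp add: inner_diff_right inner_sum_right HX flip: scaleR_Pair)
    finally show ?thesis
      by (simp add: H0 p_def sum_2 algebra_simps)
  qed
  \<comment> \<open>Pairing with a normal vector, be it \<open>H\<close> or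
    \<open>normal_vec\<close>, undoes the projection in \<open>coord_second_ff\<close>.\<close>
  have csf: "H \<bullet> coord_second_ff \<phi> y a b = 2 * m a b - (\<Sum>c\<in>UNIV. P c * A a b c)"
    "coord_second_ff \<phi> y a b \<bullet> normal_vec \<phi> s y = T a b" for a b
    by (simp add: coord_second_ff_def normal_proj_eq[OF differentiable_at_S[OF y]] inner_diff_right inner_sum_right HX H0 m_def A_def inner_commute)
      (simp add: coord_second_ff_def normal_proj_inner_normal_vec[OF y] inner_normal_vec[OF y] T_def)
  have QII: "Q_II \<phi> y H \<bullet> normal_vec \<phi> s y = (\<Sum>a\<in>UNIV. \<Sum>b\<in>UNIV. (2 * m a b - (\<Sum>c\<in>UNIV. P c * A a b c)) * R a b)"
    unfolding Q_II_eq[OF smooth S y, folded K_def] R_def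
    by (simp add: inner_sum_left csf) (simp add: sum_2 K21 algebra_simps)
  have W: "(\<Sum>a\<in>UNIV. \<Sum>b\<in>UNIV. (\<Sum>e\<in>UNIV. K a e * (p e * P b - (\<Sum>f\<in>UNIV. h e f * K f b))) * T a b)
      = (\<Sum>a\<in>UNIV. \<Sum>b\<in>UNIV. P a * P b * T a b) - (\<Sum>e\<in>UNIV. \<Sum>f\<in>UNIV. h e f * R e f)"
    unfolding P(1)[of 1] P(1)[of 2] R_def sum_2 by (simp add: K21 sym algebra_simps)
  have h: "h a b = n a b + n b a" for a b
    by (simp add: h_def n_def inner_commute)
  have "(normal_proj \<phi> y (laplace_beltrami_vec \<phi> (mean_curvature \<phi>) y)
      - (2 * (norm H)\<^sup>2) *\<^sub>R H + 2 *\<^sub>R Q_II \<phi> y H) \<bullet> normal_vec \<phi> s y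
    = laplace_beltrami_vec \<phi> (mean_curvature \<phi>) y \<bullet> normal_vec \<phi> s y - 4 * (norm H)\<^sup>2 * C y $ s
      + 2 * (Q_II \<phi> y H \<bullet> normal_vec \<phi> s y)"
    by (simp add: inner_add_left inner_diff_left normal_proj_inner_normal_vec[OF y] HN)
  \<comment> \<open>The \<open>Q_II\<close> term cancels the \<open>m\<close>-part of
    \<open>Q\<close> and the terms \<open>A b d f * P f\<close>. The terms
    \<open>A b f d * P f\<close> cancel those from the third derivatives, by symmetry of
    \<open>A\<close> and \<open>R\<close>. The two multiples of \<open>P\<close> times
    \<open>pd C\<close>, 4 and 4, add up to the 8 on the right, and the \<open>n\<close>-part of
    \<open>Q\<close> becomes \<open>h\<close>.\<close>
  also have "\<dots> = 2 * ((\<Sum>a\<in>UNIV. \<Sum>b\<in>UNIV. K a b * pd a (pd b C) y $ s)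
      + ((\<Sum>a\<in>UNIV. \<Sum>b\<in>UNIV. P a * P b * T a b) - (\<Sum>e\<in>UNIV. \<Sum>f\<in>UNIV. h e f * R e f))
      - 2 * (\<Sum>a\<in>UNIV. (P a + P a) * pd a C y $ s)
      + 2 * ((\<Sum>a\<in>UNIV. p a * P a) - 4 * (C y \<bullet> C y)) * C y $ s)"
    unfolding lap QII HH h Q_def by (simp add: sum_2 sym R21 algebra_simps)
  finally show ?thesis
    unfolding W[symmetric] by (simp only: P[symmetric] T_def)
qed

end

end

theorem theorem6p2:
  fixes r :: real
    and \<phi> :: "real^2 \<Rightarrow> real^'k::finite"
    and c :: "nat \<Rightarrow> real^2 \<Rightarrow> real^'k"
    and d :: "nat \<Rightarrow> nat \<Rightarrow> real^2 \<Rightarrow> real^'k"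
    and y :: "real^2" and s :: 'k
  assumes "r > 0"
    and "smooth_on (ball 0 r) \<phi>"
    and "\<And>i. i \<in> {2..3} \<Longrightarrow> smooth_on (ball 0 r) (c i)"
    and "\<And>i j. 4 \<le> i \<Longrightarrow> j \<le> (i - 1) div 3 \<Longrightarrow> smooth_on (ball 0 r) (d i j)"
    and "formally_solves_on (ball 0 r) (log_ansatz \<phi> c d)"
    and "y \<in> ball 0 r"
  shows "d 4 1 y $ s =
    - (1 / 8) * sqrt (1 + (norm (grad (\<lambda>z. \<phi> z $ s) y))\<^sup>2) *
      ((normal_proj \<phi> y (laplace_beltrami_vec \<phi> (mean_curvature \<phi>) y)
        - (2 * (norm (mean_curvature \<phi> y))\<^sup>2) *\<^sub>R mean_curvature \<phi> y
        + 2 *\<^sub>R Q_II \<phi> y (mean_curvature \<phi> y)) \<bullet> unit_normal \<phi> s y)"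
proof -
  let ?S = "ball (0 :: real^2) r"
  have S: "open ?S" by simp
  note smooth = assms(2) and y = assms(6)
  have C: "smooth_on ?S (c 2)" using assms(3) by simp
  note d\<phi> = smooth_on_imp_differentiable[OF smooth] and dC = smooth_on_imp_differentiable[OF C]
  have pd\<phi>: "pd a (\<lambda>z. \<phi> z $ l) z = pd a \<phi> z $ l" and pdC: "pd a (\<lambda>z. c 2 z $ l) z = pd a (c 2) z $ l"
    if "z \<in> ?S" for a l z
    using that by (simp_all add: pd_vec_nth d\<phi> dC)
  have pp\<phi>: "pd a (pd b (\<lambda>z. \<phi> z $ l)) z = pd a (pd b \<phi>) z $ l"
    and ppC: "pd a (pd b (\<lambda>z. c 2 z $ l)) z = pd a (pd b (c 2)) z $ l" if "z \<in> ?S" for a b l z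
    by (rule pd_pd_vec_nth[OF S smooth that smooth], rule pd_pd_vec_nth[OF S smooth that C])
  have inner: "(\<Sum>l\<in>UNIV. v $ l * w $ l) = v \<bullet> w" for v w :: "real^'k"
    by (simp add: inner_vec_def)
  have G: "(if a = b then 1 else 0) + pd a \<phi> z \<bullet> pd b \<phi> z = graph_metric \<phi> z $ a $ b" if "z \<in> ?S" for a b z
    by (simp add: graph_metric_nth[OF d\<phi>[OF that]])
  have det: "graph_metric \<phi> z $ 1 $ 1 * graph_metric \<phi> z $ 2 $ 2 - graph_metric \<phi> z $ 1 $ 2 * graph_metric \<phi> z $ 2 $ 1 \<noteq> 0"
    if "z \<in> ?S" for z
    using det_graph_metric_pos[OF d\<phi>[OF that]] by (simp add: det_2)
  have mss: "formal_mss (log_ansatz \<phi> c d) l z = 0" if "z \<in> ?S" for l z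
    using assms(5) that by (simp add: formally_solves_on_def)
  \<comment> \<open>Splitting the sum in \<open>h\<close> turns it into two inner products.\<close>
  note coeffs = formal_mss_log_ansatz_eq_0D[where \<phi> = \<phi> and c = c and d = d, unfolded sum.distrib]
  \<comment> \<open>On the whole ball and not just at \<open>y\<close>, because this equation gets
    differentiated.\<close>
  have tr: "(\<Sum>a\<in>UNIV. \<Sum>b\<in>UNIV. inverse_metric \<phi> z a b *\<^sub>R pd a (pd b \<phi>) z) = 4 *\<^sub>R c 2 z" if z: "z \<in> ?S" for z
    using coeffs(1)[where y = z and K = "inverse_metric \<phi> z", unfolded pd\<phi>[OF z] pp\<phi>[OF z] inner G[OF z],
        OF mss[OF z] inverse_metric_mult_left[OF d\<phi>[OF z]] det[OF z] smooth_on_imp_differentiable[OF smooth_on_vec_nth[OF S C] z]]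
    by (simp add: vec_eq_iff)
  \<comment> \<open>Doubling \<open>4 d41 + E = 0\<close> matches the factor 2 in
    \<open>curvature_expression_eq\<close> and gives the 8.\<close>
  have dbl: "4 * x + t1 + t2 - t3 + t4 = 0 \<Longrightarrow> 8 * x = - (2 * (t1 + t2 - t3 + t4))" for x t1 t2 t3 t4 :: real
    by algebra
  have "8 * d 4 1 y $ s = - ((normal_proj \<phi> y (laplace_beltrami_vec \<phi> (mean_curvature \<phi>) y)
        - (2 * (norm (mean_curvature \<phi> y))\<^sup>2) *\<^sub>R mean_curvature \<phi> y
        + 2 *\<^sub>R Q_II \<phi> y (mean_curvature \<phi> y)) \<bullet> normal_vec \<phi> s y)"
    using coeffs(2)[where y = y and s = s and K = "inverse_metric \<phi> y", unfolded pd\<phi>[OF y] pdC[OF y] pp\<phi>[OF y] ppC[OF y] inner G[OF y],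
        OF mss[OF y] inverse_metric_mult_left[OF d\<phi>[OF y]] det[OF y] smooth_on_imp_differentiable[OF smooth_on_vec_nth[OF S C] y]]
    by (subst curvature_expression_eq[OF S smooth C tr y]) (erule dbl | assumption)+
  moreover have "sqrt (1 + (norm (grad (\<lambda>z. \<phi> z $ s) y))\<^sup>2) \<noteq> 0"
    by (metis add_pos_nonneg less_irrefl real_sqrt_gt_0_iff zero_le_power2 zero_less_one)
  then have "normal_vec \<phi> s y = sqrt (1 + (norm (grad (\<lambda>z. \<phi> z $ s) y))\<^sup>2) *\<^sub>R unit_normal \<phi> s y"
    by (simp add: unit_normal_def normal_vec_def)
  ultimately show ?thesis
    by (simp add: mult.assoc)
qed

end
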